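(* Let $r_{\max} := \sqrt{10} - \frac{3}{2} = 1.66227\cdots$ and $$r_1 := \frac{48 + \sqrt{10}}{31} = 1.65039 \cdots .$$ Then there is no Sturmian word $x$ satisfying $$r_1 < \mathrm{rep}(x) < r_{\max}.$$ Moreover, $r_1$ is an accumulation point of the set $\mathrm{rep}(\mathbf{St}) = \{\mathrm{rep}(x) \mid x \in \mathbf{St}\} \subset \mathbb{R}$.
   Context: Words are over the alphabet $\{0,1\}$. For an infinite word $x = x_1x_2\cdots$ write $x_i^{j} = x_i x_{i+1}\cdots x_j$. Let $p(n,x)$ be the number of distinct factors (blocks of consecutive letters) of length $n$ occurring in $x$. An infinite word $x$ is Sturmian if $p(n,x) = n+1$ for all $n \ge 1$; $\mathbf{St}$ is the set of all Sturmian words over $\{0,1\}$. For $n \ge 1$, $$r(n,x) = \min\{ m \geq 1 \mid x_{i}^{i+n-1} = x_{m-n+1}^{m} \text{ for some } i \text{ with } 1 \leq i \leq m-n\},$$ i.e. the length of the shortest prefix of $x$ containing two (possibly overlapping) occurrences of some factor of length $n$. The exponent of repetition is $\mathrm{rep}(x) = \liminf_{n\to\infty} r(n,x)/n$. *)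

theory Defs
  imports "HOL-Analysis.Analysis" "HOL-Library.Omega_Words_Fun"
begin

text \<open>
  Infinite words are indexed from 0 here: the letter \<open>x\<^sub>i\<close> (\<open>i \<ge> 1\<close>) of the mathematical
  text is \<open>x (i - 1)\<close>.  Hence the block \<open>x\<^sub>i \<dots> x\<^sub>j\<close> is \<open>x [i - 1 \<rightarrow> j]\<close>,
  the right end point of \<open>x [a \<rightarrow> b]\<close> being exclusive.
\<close>

definition factors :: "nat \<Rightarrow> 'a word \<Rightarrow> 'a list set"
  where "factors n x = {x [i \<rightarrow> i + n] | i. True}"

definition complexity :: "nat \<Rightarrow> 'a word \<Rightarrow> nat"
  where "complexity n x = card (factors n x)"

definition Sturmian :: "nat word set"
  where "Sturmian = {x. range x \<subseteq> {0, 1} \<and> (\<forall>n\<ge>1. complexity n x = n + 1)}"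

text \<open>
  In the following definition \<open>i\<close> is the index of the text shifted by one, so that
  \<open>1 \<le> i \<le> m - n\<close> becomes \<open>i + n < m\<close>.
  Over a finite alphabet such an \<open>m\<close> always exists, by the pigeonhole principle.
\<close>

definition rep_fun :: "nat \<Rightarrow> 'a word \<Rightarrow> nat"
  where "rep_fun n x =
    (LEAST m. 1 \<le> m \<and> (\<exists>i. i + n < m \<and> x [i \<rightarrow> i + n] = x [m - n \<rightarrow> m]))"

text \<open>
  The limit inferior is taken in the extended reals, where it always exists.
  The value of the quotient at \<open>n = 0\<close> is irrelevant to it.
\<close>

definition rep :: "'a word \<Rightarrow> ereal"
  where "rep x = liminf (\<lambda>n. ereal (real (rep_fun n x) / real n))"

definition r_max :: real
  where "r_max = sqrt 10 - 3 / 2"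

definition r_one :: real
  where "r_one = (48 + sqrt 10) / 31"

end

theory Submission
  imports Defs "HOL-Library.Sublist"
begin

text \<open>
  A Sturmian word is, after a prefix \<open>w\<close>, a concatenation of the two return words \<open>u\<close>, \<open>v\<close> of
  each of its bispecial factors \<open>b\<close>, and \<open>w\<close> is a suffix of one of them, say of \<open>u\<close>.  Passing to
  the next bispecial factor is one of three moves on the lengths \<open>(A, C, D)\<close> of \<open>(u, v, w)\<close>, and
  since \<open>r(n, x) - n\<close> is constant between the critical values of \<open>n\<close>, \<open>rep x - 1\<close> is the lower
  limit of the quantities \<open>A / (A + C)\<close> (move 1) and \<open>min ((D + C) / (A + C)) (A / (D + C))\<close>
  (moves 2 and 3).

  If these all exceed \<open>r_one - 1\<close>, linear arithmetic excludes move 1 and leaves only words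
  composed of the blocks \<open>2223\<close> and \<open>22223\<close>; the linear form \<open>3 D - 2 A + C\<close>, invariant under
  the block \<open>2223\<close>, shows that \<open>22223\<close> occurs at most once.  Hence the moves are ultimately
  periodic with period \<open>2223\<close>, which gives \<open>r_max\<close>.  The periodic moves \<open>2 (2223)\<^sup>k\<close> have
  exponents smaller than \<open>r_one\<close> that tend to \<open>r_one\<close>.
\<close>

section \<open>Frames and repetitions\<close>

text \<open>Origin of the constants: the block \<open>2223\<close> maps (A, C) to (5 A + 3 C, 2 A +
  C), with eigenvalues 3 + sqrt 10 and 3 - sqrt 10. Along repeated blocks C / A and D / A tend to
  (sqrt 10 - 2) / 3 and (8 - sqrt 10) / 9, and \<open>r_max - 1\<close> is the value of A / (D + C)
  at the move 3 of the block in this limit direction, the tightest of its conditions. With one extra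
  move 2 in front of the block, the same quotient has the limit \<open>r_one - 1\<close>. At this
  threshold the dominant part of A - \<open>(r_one - 1)\<close> (D + C) cancels exactly, so its sign
  is decided by the two remaining eigenforms: a contracting one and the invariant 3 D - 2 A + C. A
  long block makes the invariant positive, of the order of A at that block, and this violates the
  condition at the next long block, however far away it is. The violation becomes small relative to
  A when the long blocks are far apart, which is why \<open>r_one\<close> is approached from
  below.\<close>

abbreviation factor_at :: "'a word \<Rightarrow> nat \<Rightarrow> nat \<Rightarrow> 'a list"
  where "factor_at x n i \<equiv> subsequence x i (i + n)"

definition starts :: "'a list \<Rightarrow> 'a word \<Rightarrow> bool"
  where "starts l x \<longleftrightarrow> (\<forall>i<length l. x i = l ! i)"

lemma starts_append_left: "starts (k @ l) x \<Longrightarrow> starts k x"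
  by (auto simp: starts_def nth_append)

lemma starts_nth: "starts l x \<Longrightarrow> i < length l \<Longrightarrow> x i = l ! i"
  by (simp add: starts_def)

lemma subsequence_eqI: "(\<And>i. i < n \<Longrightarrow> x (p + i) = y (q + i)) \<Longrightarrow> factor_at x n p = factor_at y n q"
  by (rule nth_equalityI) (auto simp: subsequence_def)

lemma starts_subsequence:
  "starts l x \<Longrightarrow> p + n \<le> length l \<Longrightarrow> factor_at x n p = take n (drop p l)"
  by (rule nth_equalityI) (auto simp: subsequence_def starts_def)

lemma rep_fun_le:
  assumes "i < t" "\<And>k. k < n \<Longrightarrow> x (i + k) = x (t + k)"
  shows "rep_fun n x \<le> t + n"
  unfolding rep_fun_def
proof (rule Least_le, intro conjI exI)
  show "1 \<le> t + n" "i + n < t + n" using assms(1) by auto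
  show "factor_at x n i = subsequence x (t + n - n) (t + n)"
    using subsequence_eqI[of n x i x t] assms(2) by simp
qed

text \<open>Finiteness guarantees some repetition, so that the \<open>LEAST\<close> in
  \<open>rep_fun\<close> satisfies its own predicate; the repetition found there would contradict
  injectivity if it ended too early.\<close>

lemma rep_fun_ge:
  assumes fin: "finite (factors n x)"
    and inj: "inj_on (\<lambda>i. factor_at x n i) {..<t}"
  shows "t + n \<le> rep_fun n x"
proof -
  let ?P = "\<lambda>m. 1 \<le> m \<and> (\<exists>i. i + n < m \<and> factor_at x n i = subsequence x (m - n) m)"
  have "\<not> inj_on (\<lambda>i. factor_at x n i) (UNIV :: nat set)"
  proof
    assume "inj_on (\<lambda>i. factor_at x n i) (UNIV :: nat set)"
    moreover have "range (\<lambda>i. factor_at x n i) \<subseteq> factors n x"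
      by (auto simp: factors_def)
    ultimately show False using fin by (meson finite_imageD finite_subset infinite_UNIV_nat)
  qed
  then obtain i j where ij: "i < j" "factor_at x n i = factor_at x n j"
    by (metis (mono_tags, lifting) injI linorder_neqE_nat)
  then have "?P (j + n)" by auto
  then have "?P (rep_fun n x)" unfolding rep_fun_def by (rule LeastI)
  then obtain k where k: "k + n < rep_fun n x"
    "factor_at x n k = factor_at x n (rep_fun n x - n)"
    by auto
  show ?thesis
  proof (rule ccontr)
    assume "\<not> ?thesis"
    then have "rep_fun n x - n \<in> {..<t}" "k \<in> {..<t}" "k \<noteq> rep_fun n x - n" using k by auto
    with inj k(2) show False by (auto dest: inj_onD)
  qed
qed

text \<open>
  A frame \<open>(u, v, w, b)\<close> consists of the two return words \<open>u\<close>, \<open>v\<close> of the bispecial factor \<open>b\<close>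
  and the part \<open>w\<close> of the infinite word before the first occurrence of \<open>b\<close>.
\<close>

type_synonym 'a frame = "'a list \<times> 'a list \<times> 'a list \<times> 'a list"

text \<open>The two inequations say that the return words give \<open>b\<close> different letters on
  its left and on its right. The length equation is the one of central words; it makes the Rauzy
  graph of order n have exactly n + 1 vertices.\<close>

fun is_frame :: "'a frame \<Rightarrow> bool"
  where "is_frame (u, v, w, b) \<longleftrightarrow> u \<noteq> [] \<and> v \<noteq> [] \<and> last u \<noteq> last v \<and>
    length b + 2 = length u + length v \<and> Sublist.prefix b (u @ b) \<and> Sublist.prefix b (v @ b) \<and>
    (u @ b) ! length b \<noteq> (v @ b) ! length b \<and> Sublist.suffix w u"

text \<open>Each move recodes by \<open>u\<close> and \<open>u @ v\<close>, or by \<open>v\<close>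
  and \<open>v @ u\<close>. In move 2 the recoding has to begin with \<open>u\<close>, so a leading
  \<open>v\<close> is absorbed into the initial part. The order of the new pair is chosen so that
  the new initial part is again a suffix of the first word.\<close>

fun next_frame :: "nat \<Rightarrow> 'a frame \<Rightarrow> 'a frame"
  where "next_frame m (u, v, w, b) =
    (if m = 1 then (u, u @ v, w, u @ b)
     else if m = 2 then (u @ v, u, w @ v, u @ b)
     else (v @ u, v, w, v @ b))"

lemma prefix_nth_eq: "Sublist.prefix a c \<Longrightarrow> i < length a \<Longrightarrow> c ! i = a ! i"
  by (auto simp: Sublist.prefix_def nth_append)

text \<open>Stated without \<open>w\<close>, because all three moves are this step up to exchanging
  \<open>u\<close> and \<open>v\<close> and reordering the new pair.\<close>

lemma is_frame_step:
  assumes "u \<noteq> []" "v \<noteq> []" "last u \<noteq> last v" "length b + 2 = length u + length v"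
    "Sublist.prefix b (u @ b)" "Sublist.prefix b (v @ b)" "(u @ b) ! length b \<noteq> (v @ b) ! length b"
  shows "last u \<noteq> last (u @ v)" "length (u @ b) + 2 = length u + length (u @ v)"
    "Sublist.prefix (u @ b) (u @ (u @ b))" "Sublist.prefix (u @ b) ((u @ v) @ (u @ b))"
    "(u @ (u @ b)) ! length (u @ b) \<noteq> ((u @ v) @ (u @ b)) ! length (u @ b)"
proof -
  show "last u \<noteq> last (u @ v)" "length (u @ b) + 2 = length u + length (u @ v)"
    "Sublist.prefix (u @ b) (u @ (u @ b))"
    using assms by auto
  have p: "Sublist.prefix (v @ b) (v @ u @ b)" using assms by simp
  show "Sublist.prefix (u @ b) ((u @ v) @ (u @ b))" using p assms(6) by (auto intro: prefix_order.trans)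
  have "(v @ u @ b) ! length b = (v @ b) ! length b"
    using prefix_nth_eq[OF p] assms(2) by simp
  then show "(u @ (u @ b)) ! length (u @ b) \<noteq> ((u @ v) @ (u @ b)) ! length (u @ b)"
    using assms(7) by (simp add: nth_append)
qed

lemma is_frame_next:
  assumes "is_frame F" shows "is_frame (next_frame m F)"
proof (cases F)
  case (fields u v w b)
  note 1 = is_frame_step[of u v b] and 2 = is_frame_step[of v u b]
  have sw: "Sublist.suffix w (v @ u)" "Sublist.suffix (w @ v) (u @ v)"
    using assms fields by (auto simp: suffix_appendI)
  show ?thesis
    using assms fields 1 2 sw by (auto simp: add.commute[of "length u"])
qed

lemma is_frame_swap: "is_frame (u, v, [], b) \<Longrightarrow> is_frame (v, u, [], b)"
  by auto

lemma prefix_concat: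
  assumes "is_frame (u, v, w, b)" "zs \<in> lists {u, v}"
  shows "Sublist.prefix b (concat zs @ b)"
  using assms(2)
proof (induction zs)
  case (Cons z zs)
  then have "Sublist.prefix (z @ b) (z @ concat zs @ b)" "Sublist.prefix b (z @ b)" using assms(1) by auto
  then show ?case by (auto intro: prefix_order.trans)
qed auto

section \<open>Words tiled by two return words, and their factors\<close>

fun tiled :: "'a word \<Rightarrow> 'a frame \<Rightarrow> bool"
  where "tiled x (u, v, w, b) \<longleftrightarrow>
    (\<forall>L. \<exists>zs\<in>lists {u, v}. L \<le> length (concat zs) \<and> starts (w @ concat zs) x)"

text \<open>Every long enough product of tiles begins with \<open>b\<close>, so each tile
  \<open>c\<close> is followed by \<open>b\<close> in the word.\<close>

lemma starts_tile:
  assumes "is_frame (u, v, w, b)" "zs \<in> lists {u, v}" "starts (k @ c @ concat zs) x"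
    "length b \<le> length (concat zs)" "i < length c + length b"
  shows "x (length k + i) = (c @ b) ! i"
proof -
  obtain r where r: "concat zs @ b = b @ r" using prefix_concat[OF assms(1,2)] by (auto simp: Sublist.prefix_def)
  have "x (length k + i) = (c @ concat zs) ! i"
    using starts_nth[OF assms(3), of "length k + i"] assms(4,5) by simp
  also have "\<dots> = (c @ concat zs @ b) ! i" using assms(4,5) by (auto simp: nth_append)
  also have "\<dots> = (c @ b) ! i" unfolding r using assms(5) by (auto simp: nth_append)
  finally show ?thesis .
qed

lemma concat_position:
  "p < length (concat ys) \<Longrightarrow>
    \<exists>ys1 c ys2. ys = ys1 @ c # ys2 \<and> length (concat ys1) \<le> p \<and> p < length (concat ys1) + length c"
proof (induction ys arbitrary: p)
  case (Cons y ys)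
  show ?case
  proof (cases "p < length y")
    case True
    then show ?thesis by (intro exI[of _ "[]"] exI[of _ y] exI[of _ ys]) auto
  next
    case False
    then have "p - length y < length (concat ys)" using Cons.prems by auto
    from Cons.IH[OF this] obtain ys1 c ys2 where
      "ys = ys1 @ c # ys2" "length (concat ys1) \<le> p - length y" "p - length y < length (concat ys1) + length c"
      by blast
    then show ?thesis using False by (intro exI[of _ "y # ys1"] exI[of _ c] exI[of _ ys2]) auto
  qed
qed auto

lemma factor_in_tile:
  assumes fr: "is_frame (u, v, w, b)" and ti: "tiled x (u, v, w, b)" and n: "n \<le> length b"
  shows "\<exists>c\<in>{u, v}. \<exists>i<length c. factor_at x n p = take n (drop i (c @ b))"
proof -
  obtain zs where zs: "zs \<in> lists {u, v}" "p + n + 1 \<le> length (concat zs)" "starts (w @ concat zs) x"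
    using ti by (auto simp: Bex_def)
  \<comment> \<open>Completing \<open>w\<close> to \<open>u\<close> on the left turns the word into
    a product of whole tiles, so that every position lies in one of them. A factor of length at most
    \<open>length b\<close> that starts in the tile \<open>c\<close> fits into
    \<open>c @ b\<close>.\<close>
  obtain e where e: "u = e @ w" using fr by (auto simp: Sublist.suffix_def)
  have len: "length e + p < length (concat (u # zs))" using zs(2) e by simp
  obtain ys1 c ys2 where ys: "u # zs = ys1 @ c # ys2" "length (concat ys1) \<le> length e + p"
    "length e + p < length (concat ys1) + length c"
    using concat_position[OF len] by blast
  have in_l: "c \<in> {u, v}" "ys2 \<in> lists {u, v}"
  proof -
    have "ys1 @ c # ys2 \<in> lists {u, v}" using zs(1) unfolding ys(1)[symmetric] by auto
    then show "c \<in> {u, v}" "ys2 \<in> lists {u, v}" by auto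
  qed
  obtain r where r: "concat ys2 @ b = b @ r"
    using prefix_concat[OF fr in_l(2)] by (auto simp: Sublist.prefix_def)
  define i where "i = length e + p - length (concat ys1)"
  have "factor_at x n p = take n (drop p (w @ concat zs))"
    using starts_subsequence[OF zs(3)] zs(2) by simp
  also have "\<dots> = take n (drop (length e + p) (concat (u # zs)))" using e by simp
  also have "\<dots> = take n (drop (length e + p) (concat (u # zs) @ b))" using zs(2) e by simp
  also have "\<dots> = take n (drop i (c @ b @ r))" unfolding ys(1) i_def using ys(2) r by simp
  also have "\<dots> = take n (drop i (c @ b))" using n ys(2,3) unfolding i_def by simp
  finally show ?thesis using in_l(1) ys(2,3) i_def by (intro bexI[of _ c] exI[of _ i]) auto
qed

text \<open>
  Below \<open>Inl i\<close> and \<open>Inr i\<close> denote position \<open>i\<close> in the cycles \<open>u\<close> and \<open>v\<close> of the Rauzy graph of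
  order \<open>n\<close>; the first \<open>length b + 1 - n\<close> positions of the two cycles are the same vertices.
\<close>

fun vertex :: "nat \<Rightarrow> 'a frame \<Rightarrow> nat + nat \<Rightarrow> 'a list"
  where "vertex n (u, v, w, b) (Inl i) = take n (drop i (u @ b))"
  | "vertex n (u, v, w, b) (Inr i) = take n (drop i (v @ b))"

lemma vertex_common:
  assumes "is_frame (u, v, w, b)" "i + n \<le> length b"
  shows "vertex n (u, v, w, b) (Inl i) = vertex n (u, v, w, b) (Inr i)"
proof -
  obtain r1 r2 where "u @ b = b @ r1" "v @ b = b @ r2" using assms(1) by (auto simp: Sublist.prefix_def)
  then show ?thesis using assms(2) by simp
qed

text \<open>Common positions are kept on the side of \<open>v\<close> only. This leaves (|u| - (|b|
  + 1 - n)) + |v| = n + 1 elements.\<close>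

definition vertices :: "nat \<Rightarrow> 'a frame \<Rightarrow> (nat + nat) set"
  where "vertices n F = (case F of (u, v, w, b) \<Rightarrow>
    Inl ` {length b + 1 - n ..< length u} \<union> Inr ` {..<length v})"

lemma card_vertices:
  assumes "is_frame (u, v, w, b)" "n \<le> length b" "length v \<le> n + 1"
  shows "card (vertices n (u, v, w, b)) = n + 1"
proof -
  have "card (vertices n (u, v, w, b)) = (length u - (length b + 1 - n)) + length v"
    unfolding vertices_def by (simp, subst card_Un_disjoint) (auto simp: card_image)
  then show ?thesis using assms by auto
qed

lemma factors_subset_vertices:
  assumes fr: "is_frame (u, v, w, b)" and "tiled x (u, v, w, b)" "n \<le> length b" "length u \<le> n + 1"
  shows "factors n x \<subseteq> vertex n (u, v, w, b) ` vertices n (u, v, w, b)"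
proof
  fix f assume "f \<in> factors n x"
  then obtain p where "f = factor_at x n p" by (auto simp: factors_def)
  with factor_in_tile[OF assms(1-3), of p] obtain c i where
    c: "c \<in> {u, v}" "i < length c" "f = take n (drop i (c @ b))" by blast
  show "f \<in> vertex n (u, v, w, b) ` vertices n (u, v, w, b)"
  proof (cases "c = v")
    case True
    then show ?thesis using c by (intro image_eqI[of _ _ "Inr i"]) (auto simp: vertices_def)
  next
    case False
    then have cu: "c = u" using c by auto
    show ?thesis
    proof (cases "i + n \<le> length b")
      case True
      have "i < length v" using True assms by auto
      then show ?thesis using c cu vertex_common[OF fr True]
        by (intro image_eqI[of _ _ "Inr i"]) (auto simp: vertices_def)
    next
      case False
      then show ?thesis using c cu by (intro image_eqI[of _ _ "Inl i"]) (auto simp: vertices_def)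
    qed
  qed
qed

text \<open>The n + 1 factors are covered by n + 1 vertices, so the covering is a bijection and
  distinct vertices carry distinct factors.\<close>

lemma inj_on_vertex:
  assumes fr: "is_frame (u, v, w, b)" and "tiled x (u, v, w, b)" "n \<le> length b"
    "length u \<le> n + 1" "length v \<le> n + 1" and cx: "complexity n x = n + 1"
  shows "inj_on (vertex n (u, v, w, b)) (vertices n (u, v, w, b))"
proof (rule eq_card_imp_inj_on)
  show fin: "finite (vertices n (u, v, w, b))" by (auto simp: vertices_def)
  have "n + 1 \<le> card (vertex n (u, v, w, b) ` vertices n (u, v, w, b))"
    using card_mono[OF _ factors_subset_vertices[OF assms(1-4)]] fin cx
    by (simp add: complexity_def)
  moreover have "card (vertex n (u, v, w, b) ` vertices n (u, v, w, b)) \<le> n + 1"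
    using card_image_le[OF fin] card_vertices[OF fr assms(3,5)] by metis
  ultimately show "card (vertex n (u, v, w, b) ` vertices n (u, v, w, b)) = card (vertices n (u, v, w, b))"
    using card_vertices[OF fr assms(3,5)] by simp
qed

lemma complexity_le:
  assumes "is_frame (u, v, w, b)" "tiled x (u, v, w, b)"
  shows "complexity (length b) x \<le> length b + 1"
proof -
  have "length u \<le> length b + 1" "length v \<le> length b + 1"
  proof -
    have "0 < length u" "0 < length v" "length b + 2 = length u + length v" using assms(1) by auto
    then show "length u \<le> length b + 1" "length v \<le> length b + 1" by linarith+
  qed
  then show ?thesis
    using card_mono[OF _ factors_subset_vertices[OF assms order.refl]]
      card_image_le[of "vertices (length b) (u, v, w, b)" "vertex (length b) (u, v, w, b)"]
      card_vertices[OF assms(1) order.refl]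
    unfolding complexity_def by (fastforce simp: vertices_def)
qed

section \<open>Bounds for \<open>rep_fun\<close> at the critical lengths\<close>

lemma rep_fun_le_same:
  assumes fr: "is_frame (u, v, w, b)" and st: "starts (w @ u @ b) x"
  shows "rep_fun (length b) x \<le> length u + length b"
proof (rule rep_fun_le)
  show "0 < length u" using fr by simp
  fix k assume k: "k < length b"
  obtain e where e: "u = e @ w" using fr by (auto simp: Sublist.suffix_def)
  obtain r where r: "u @ b = b @ r" using fr by (auto simp: Sublist.prefix_def)
  \<comment> \<open>Extended to the left by \<open>e\<close>, the prefix becomes
    \<open>u @ u @ b\<close>, which has period |u|.\<close>
  have sx: "x i = (u @ u @ b) ! (length e + i)" if "i < length w + length u + length b" for i
    using starts_nth[OF st, of i] that e by (simp add: nth_append)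
  have "x (length u + k) = (u @ b) ! (length e + k)"
    using sx[of "length u + k"] k e by (simp add: nth_append)
  moreover have "x (0 + k) = (u @ b) ! (length e + k)"
  proof -
    have "x k = (u @ u @ b) ! (length e + k)" using sx[of k] k by simp
    also have "u @ u @ b = (u @ b) @ r" using r by simp
    also have "((u @ b) @ r) ! (length e + k) = (u @ b) ! (length e + k)"
      using k e by (subst nth_append) simp
    finally show ?thesis by simp
  qed
  ultimately show "x (0 + k) = x (length u + k)" by simp
qed

lemma rep_fun_le_return:
  assumes fr: "is_frame (u, v, w, b)" and st: "starts (w @ v @ b) x"
  shows "rep_fun (length b) x \<le> length w + length v + length b"
proof (rule rep_fun_le)
  show "length w < length w + length v" using fr by simp
  fix k assume k: "k < length b"
  obtain r where r: "v @ b = b @ r" using fr by (auto simp: Sublist.prefix_def)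
  have "x (length w + k) = (v @ b) ! k" using starts_nth[OF st, of "length w + k"] k by simp
  also have "\<dots> = b ! k" unfolding r using k by (simp add: nth_append)
  also have "\<dots> = x (length w + length v + k)"
    using starts_nth[OF st, of "length w + length v + k"] k by (simp add: nth_append)
  finally show "x (length w + k) = x (length w + length v + k)" .
qed

text \<open>In the completed word \<open>u @ v @ b\<close> the word \<open>b\<close> starts both
  with \<open>u\<close> and with \<open>v\<close>. The first |e| letters of the first occurrence lie
  before \<open>x\<close>; the rest of \<open>b\<close> has length |b| - |e| = |w| + |v| - 2 and
  recurs after |u| letters.\<close>

lemma rep_fun_le_period:
  assumes fr: "is_frame (u, v, w, b)" and st: "starts (w @ v @ b) x"
    and n: "n + 2 = length w + length v"
  shows "rep_fun n x \<le> length u + n"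
proof (rule rep_fun_le)
  show "0 < length u" using fr by simp
  fix k assume k: "k < n"
  obtain e where e: "u = e @ w" using fr by (auto simp: Sublist.suffix_def)
  obtain r1 r2 where r: "u @ b = b @ r1" "v @ b = b @ r2" using fr by (auto simp: Sublist.prefix_def)
  have lb: "length b + 2 = length u + length v" using fr by simp
  have small: "length e + k < length b" using lb e n k by simp
  have sx: "x i = (u @ v @ b) ! (length e + i)" if "i < length w + length v + length b" for i
    using starts_nth[OF st, of i] that e by (simp add: nth_append)
  have "x (length u + k) = (v @ b) ! (length e + k)"
    using sx[of "length u + k"] small e by (simp add: nth_append)
  also have "\<dots> = b ! (length e + k)" unfolding r using small by (simp add: nth_append)
  also have "\<dots> = (u @ v @ b) ! (length e + k)"
    using r small by (metis append.assoc nth_append_left)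
  also have "\<dots> = x (0 + k)" using sx[of k] small by simp
  finally show "x (0 + k) = x (length u + k)" by simp
qed

text \<open>The prefix runs along the end of the cycle \<open>u\<close> and then along the cycle
  \<open>v\<close>; no factor recurs while no vertex is visited twice. A vertex visited twice is
  common to both cycles and belongs to positions i and i + |u|. This is excluded by t \<le> |u|, and
  also by |w| + |v| \<le> n + 1, for then all positions in \<open>w\<close> lie beyond the common
  part.\<close>

lemma rep_fun_ge_frame:
  assumes fr: "is_frame (u, v, w, b)" and ti: "tiled x (u, v, w, b)"
    and st: "starts (w @ v @ b) x"
    and n: "n \<le> length b" "length u \<le> n + 1" "length v \<le> n + 1" and cx: "complexity n x = n + 1"
    and t: "t \<le> length w + length v" "t \<le> length u \<or> length w + length v \<le> n + 1"
  shows "t + n \<le> rep_fun n x"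
proof (rule rep_fun_ge)
  show "finite (factors n x)" using cx by (auto simp: complexity_def intro: card_ge_0_finite)
  obtain e where e: "u = e @ w" using fr by (auto simp: Sublist.suffix_def)
  have lb: "length b + 2 = length u + length v" using fr by simp
  let ?F = "(u, v, w, b)" and ?c = "length b + 1 - n"
  define idx where "idx i = (if i < length w then (if length e + i < ?c then Inr (length e + i)
    else Inl (length e + i)) else Inr (i - length w) :: nat + nat)" for i
  have idx: "idx i \<in> vertices n ?F \<and> vertex n ?F (idx i) = factor_at x n i" if i: "i < t" for i
  proof (cases "i < length w")
    case True
    obtain r where r: "v @ b = b @ r" using fr by (auto simp: Sublist.prefix_def)
    have "factor_at x n i = take n (drop i (w @ v @ b))"
      using starts_subsequence[OF st, of i n] True n by simp
    also have "\<dots> = take n (drop i (w @ b))" unfolding r using True n by simp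
    also have "\<dots> = vertex n ?F (Inl (length e + i))" using e by simp
    finally have *: "vertex n ?F (Inl (length e + i)) = factor_at x n i" by simp
    show ?thesis
    proof (cases "length e + i < ?c")
      case T: True
      then show ?thesis using * vertex_common[OF fr, of "length e + i" n] n lb True
        by (auto simp: idx_def vertices_def)
    next
      case False
      then show ?thesis using * True e by (auto simp: idx_def vertices_def)
    qed
  next
    case False
    have "factor_at x n i = take n (drop i (w @ v @ b))"
      using starts_subsequence[OF st, of i n] i t n by simp
    then show ?thesis using False i t by (auto simp: idx_def vertices_def)
  qed
  have inj: "inj_on idx {..<t}"
    using t e lb n by (auto simp: inj_on_def idx_def split: if_splits)
  show "inj_on (\<lambda>i. factor_at x n i) {..<t}"
  proof (rule inj_onI)
    fix i j assume ij: "i \<in> {..<t}" "j \<in> {..<t}" "factor_at x n i = factor_at x n j"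
    then have "vertex n ?F (idx i) = vertex n ?F (idx j)" using idx by simp
    moreover have "idx i \<in> vertices n ?F" "idx j \<in> vertices n ?F" using idx ij by auto
    ultimately have "idx i = idx j" by (rule inj_onD[OF inj_on_vertex[OF fr ti n cx]])
    then show "i = j" using inj ij by (auto dest: inj_onD)
  qed
qed

definition directed :: "'a word \<Rightarrow> (nat \<Rightarrow> 'a frame) \<Rightarrow> (nat \<Rightarrow> nat) \<Rightarrow> bool"
  where "directed x F m \<longleftrightarrow> (\<forall>j. is_frame (F j) \<and> tiled x (F j) \<and> m j \<in> {1, 2, 3} \<and>
    F (Suc j) = next_frame (m j) (F j) \<and>
    (case F j of (u, v, w, b) \<Rightarrow> starts (w @ (if m j = 1 then u else v) @ b) x))"

section \<open>Right special factors and complexity\<close>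

definition right_special :: "nat \<Rightarrow> 'a word \<Rightarrow> 'a list set"
  where "right_special n x = {f. \<exists>c d. c \<noteq> d \<and> f @ [c] \<in> factors (Suc n) x \<and> f @ [d] \<in> factors (Suc n) x}"

lemma factors_Suc: "f \<in> factors n x \<Longrightarrow> \<exists>c. f @ [c] \<in> factors (Suc n) x"
proof -
  assume "f \<in> factors n x"
  then obtain i where f: "f = factor_at x n i" by (auto simp: factors_def)
  have "f @ [x (i + n)] = factor_at x (Suc n) i"
    unfolding f by (simp add: subsequence_def)
  then show ?thesis by (auto simp: factors_def)
qed

lemma factors_butlast: "f @ [c] \<in> factors (Suc n) x \<Longrightarrow> f \<in> factors n x"
proof -
  assume "f @ [c] \<in> factors (Suc n) x"
  then obtain i where "f @ [c] = factor_at x (Suc n) i" by (auto simp: factors_def)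
  then have "f = factor_at x n i" by (simp add: subsequence_def)
  then show ?thesis by (auto simp: factors_def)
qed

text \<open>Every factor has one right extension \<open>g f\<close>, and the members of
  \<open>S\<close> have a second one \<open>h f\<close>; all of these are distinct.\<close>

lemma card_factors_right_special:
  assumes S: "S \<subseteq> right_special n x" and fin: "finite (factors (Suc n) x)" "finite (factors n x)"
  shows "card (factors n x) + card S \<le> card (factors (Suc n) x)"
proof -
  have SF: "S \<subseteq> factors n x" using S factors_butlast by (fastforce simp: right_special_def)
  obtain g where g: "\<And>f. f \<in> factors n x \<Longrightarrow> f @ [g f] \<in> factors (Suc n) x"
    using bchoice[of "factors n x" "\<lambda>f c. f @ [c] \<in> factors (Suc n) x"] factors_Suc by blast
  have "\<forall>f\<in>S. \<exists>c. c \<noteq> g f \<and> f @ [c] \<in> factors (Suc n) x"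
  proof
    fix f assume "f \<in> S"
    then obtain c d where "c \<noteq> d" "f @ [c] \<in> factors (Suc n) x" "f @ [d] \<in> factors (Suc n) x"
      using S by (auto simp: right_special_def)
    moreover from this have "c \<noteq> g f \<or> d \<noteq> g f" by auto
    ultimately show "\<exists>c. c \<noteq> g f \<and> f @ [c] \<in> factors (Suc n) x" by blast
  qed
  then obtain h where h: "\<And>f. f \<in> S \<Longrightarrow> h f \<noteq> g f \<and> f @ [h f] \<in> factors (Suc n) x"
    by metis
  have ne: "g f \<noteq> h f" if "f \<in> S" for f using h[OF that] by auto
  have "card (factors n x) + card S = card ((\<lambda>f. f @ [g f]) ` factors n x \<union> (\<lambda>f. f @ [h f]) ` S)"
    using fin SF by (subst card_Un_disjoint) (auto simp: card_image inj_on_def ne intro: finite_subset)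
  also have "\<dots> \<le> card (factors (Suc n) x)"
    using fin g h by (intro card_mono) auto
  finally show ?thesis .
qed

lemma ultimately_periodic_complexity:
  assumes "p > 0" "\<And>n. n \<ge> k \<Longrightarrow> x (n + p) = x n"
  shows "complexity n x \<le> k + p"
proof -
  have "\<exists>j<k + p. factor_at x n i = factor_at x n j" for i
  proof (induction i rule: less_induct)
    case (less i)
    show ?case
    proof (cases "i < k + p")
      case False
      have "factor_at x n (i - p) = factor_at x n i"
      proof (rule subsequence_eqI)
        fix q show "x (i - p + q) = x (i + q)" using assms(2)[of "i - p + q"] False by simp
      qed
      then show ?thesis using less[of "i - p"] False assms(1) by fastforce
    qed auto
  qed
  then have "factors n x \<subseteq> factor_at x n ` {..<k + p}" by (fastforce simp: factors_def)
  then have "card (factors n x) \<le> card {..<k + p}" by (meson finite_lessThan surj_card_le)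
  then show ?thesis by (simp add: complexity_def)
qed

section \<open>Sturmian words are directed\<close>

definition blocks :: "'a list \<Rightarrow> 'a list \<Rightarrow> (nat \<Rightarrow> bool) \<Rightarrow> nat \<Rightarrow> 'a list list"
  where "blocks u v y k = map (\<lambda>i. if y i then u else v) [0..<k]"

text \<open>In \<open>tiled\<close> the product may change with the length \<open>L\<close>. Here a
  single sequence \<open>y\<close> serves for all lengths, and recoding can look at its consecutive
  pairs.\<close>

definition coded :: "'a word \<Rightarrow> 'a list \<Rightarrow> 'a list \<Rightarrow> 'a list \<Rightarrow> (nat \<Rightarrow> bool) \<Rightarrow> bool"
  where "coded x w u v y \<longleftrightarrow> (\<forall>k. starts (w @ concat (blocks u v y k)) x)"

lemma blocks_Suc: "blocks u v y (Suc k) = blocks u v y k @ [if y k then u else v]"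
  by (simp add: blocks_def)

lemma blocks_Suc_shift: "blocks u v y (Suc k) = (if y 0 then u else v) # blocks u v (\<lambda>i. y (Suc i)) k"
proof (induction k)
  case (Suc k)
  show ?case unfolding blocks_Suc[of u v y "Suc k"] Suc.IH by (simp add: blocks_Suc)
qed (simp add: blocks_def)

lemma blocks_swap: "blocks v u (\<lambda>i. \<not> y i) k = blocks u v y k"
  by (auto simp: blocks_def)

lemma blocks_lists: "blocks u v y k \<in> lists {u, v}"
  by (auto simp: blocks_def)

lemma length_concat_blocks: "u \<noteq> [] \<Longrightarrow> v \<noteq> [] \<Longrightarrow> k \<le> length (concat (blocks u v y k))"
proof (induction k)
  case (Suc k)
  have "0 < length (if y k then u else v)" using Suc.prems by auto
  moreover have "length (concat (blocks u v y (Suc k))) =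
      length (concat (blocks u v y k)) + length (if y k then u else v)"
    unfolding blocks_Suc by simp
  ultimately show ?case using Suc.IH[OF Suc.prems] by linarith
qed simp

lemma coded_swap: "coded x w u v y \<Longrightarrow> coded x w v u (\<lambda>i. \<not> y i)"
  by (simp add: coded_def blocks_swap)

lemma coded_shift: "coded x w u v y \<Longrightarrow> coded x (w @ (if y 0 then u else v)) u v (\<lambda>i. y (Suc i))"
  unfolding coded_def
proof
  fix k assume "\<forall>k. starts (w @ concat (blocks u v y k)) x"
  then have "starts (w @ concat (blocks u v y (Suc k))) x" by blast
  then show "starts ((w @ (if y 0 then u else v)) @ concat (blocks u v (\<lambda>i. y (Suc i)) k)) x"
    unfolding blocks_Suc_shift by simp
qed

lemma coded_tiled: "coded x w u v y \<Longrightarrow> is_frame (u, v, w, b) \<Longrightarrow> tiled x (u, v, w, b)"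
  using length_concat_blocks blocks_lists unfolding coded_def tiled.simps is_frame.simps by metis

lemma coded_at:
  assumes fr: "is_frame (u, v, w, b)" and co: "coded x w u v y"
    and i: "i < length (if y k then u else v) + length b"
  shows "x (length (w @ concat (blocks u v y k)) + i) = ((if y k then u else v) @ b) ! i"
proof -
  have split: "blocks u v y (Suc k + l) = blocks u v y (Suc k) @ blocks u v (\<lambda>i. y (i + Suc k)) l" for l
    by (induction l) (auto simp: blocks_Suc ac_simps blocks_def)
  let ?zs = "blocks u v (\<lambda>i. y (i + Suc k)) (length b)"
  have "starts (w @ concat (blocks u v y (Suc k + length b))) x" using co by (simp add: coded_def)
  then have "starts ((w @ concat (blocks u v y k)) @ (if y k then u else v) @ concat ?zs) x"
    unfolding split blocks_Suc by simp
  moreover have "length b \<le> length (concat ?zs)" using fr by (intro length_concat_blocks) auto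
  ultimately show ?thesis using starts_tile[OF fr blocks_lists] i by blast
qed

lemma coded_starts: "is_frame (u, v, w, b) \<Longrightarrow> coded x w u v y \<Longrightarrow> starts (w @ (if y 0 then u else v) @ b) x"
proof -
  assume fr: "is_frame (u, v, w, b)" and co: "coded x w u v y"
  have "starts w x" using co by (auto simp: coded_def dest: starts_append_left)
  let ?c = "if y 0 then u else v"
  have "x i = (w @ ?c @ b) ! i" if "i < length (w @ ?c @ b)" for i
  proof (cases "i < length w")
    case True
    then show ?thesis using \<open>starts w x\<close> by (simp add: starts_def nth_append_left)
  next
    case False
    have "i - length w < length ?c + length b" using that False by auto
    then have "x (length w + (i - length w)) = (?c @ b) ! (i - length w)"
      using coded_at[OF fr co, of "i - length w" 0] by (simp add: blocks_def)
    then show ?thesis using False by (simp add: nth_append_right)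
  qed
  then show ?thesis by (simp add: starts_def)
qed

text \<open>Since the first block is \<open>u\<close> and \<open>v\<close> is never followed by
  \<open>v\<close>, each \<open>v\<close> can be joined to the \<open>u\<close> before it. The k-th
  new block begins at index \<open>pos k\<close> of \<open>y\<close> and is a single
  \<open>u\<close> exactly if the next block is again \<open>u\<close>.\<close>

lemma coded_recode:
  assumes co: "coded x w u v y" and y0: "y 0" and iso: "\<And>i. y i \<or> y (Suc i)"
  shows "\<exists>y'. coded x w u (u @ v) y'"
proof -
  define pos where "pos = rec_nat 0 (\<lambda>_ p. if y (Suc p) then Suc p else Suc (Suc p))"
  have pos: "pos 0 = 0" "pos (Suc k) = (if y (Suc (pos k)) then Suc (pos k) else Suc (Suc (pos k)))" for k
    by (simp_all add: pos_def)
  have ypos: "y (pos k)" for k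
    by (induction k) (use y0 iso in \<open>auto simp: pos\<close>)
  have eq: "concat (blocks u (u @ v) (\<lambda>k. y (Suc (pos k))) k) = concat (blocks u v y (pos k))" for k
    by (induction k) (use ypos in \<open>auto simp: pos blocks_Suc, simp add: blocks_def\<close>)
  show ?thesis
    using co by (intro exI[of _ "\<lambda>k. y (Suc (pos k))"]) (simp add: coded_def eq)
qed

text \<open>A constant tail of \<open>y\<close> makes \<open>x\<close> ultimately periodic, hence of
  bounded complexity.\<close>

lemma coded_not_constant:
  assumes fr: "is_frame (u, v, w, b)" and co: "coded x w u v y"
    and unb: "\<And>K. \<exists>n. complexity n x > K"
  shows "\<exists>i\<ge>k. y i \<noteq> c"
proof (rule ccontr)
  assume "\<not> (\<exists>i\<ge>k. y i \<noteq> c)"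
  then have const: "\<And>i. i \<ge> k \<Longrightarrow> y i = c" by blast
  define z where "z = (if c then u else v)"
  define p where "p = length (w @ concat (blocks u v y k))"
  have z: "0 < length z" using fr by (auto simp: z_def)
  have split: "concat (blocks u v y (k + l)) = concat (blocks u v y k) @ concat (replicate l z)" for l
  proof (induction l)
    case (Suc l)
    have "concat (replicate l z) @ z = z @ concat (replicate l z)" by (induction l) auto
    then show ?case using Suc const[of "k + l"] by (simp add: blocks_Suc z_def)
  qed simp
  have xp: "x (p + j) = concat (replicate l z) ! j" if "j < length (concat (replicate l z))" for j l
  proof -
    have "starts ((w @ concat (blocks u v y k)) @ concat (replicate l z)) x"
      using co split[of l] by (metis append.assoc coded_def)
    from starts_nth[OF this, of "p + j"] that
    have "x (p + j) = ((w @ concat (blocks u v y k)) @ concat (replicate l z)) ! (p + j)"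
      by (simp add: p_def)
    also have "\<dots> = concat (replicate l z) ! j" unfolding p_def by (rule nth_append_length_plus)
    finally show ?thesis .
  qed
  have len: "j < length (concat (replicate (Suc j) z))" for j
  proof (induction j)
    case (Suc j)
    have "length (concat (replicate (Suc (Suc j)) z)) = length z + length (concat (replicate (Suc j) z))"
      by simp
    then show ?case using Suc z by linarith
  qed (use z in simp)
  have "x (n + length z) = x n" if "n \<ge> p" for n
  proof -
    let ?j = "n - p"
    have "x (p + (length z + ?j)) = concat (replicate (Suc (Suc ?j)) z) ! (length z + ?j)"
      using len[of ?j] by (intro xp) simp
    also have "\<dots> = concat (replicate (Suc ?j) z) ! ?j" by (simp only: replicate_Suc concat.simps nth_append_length_plus)
    also have "\<dots> = x (p + ?j)" using len[of ?j] by (intro xp[symmetric])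
    finally show ?thesis using that by (simp add: add.commute add.left_commute)
  qed
  then have "complexity n x \<le> p + length z" for n
    by (rule ultimately_periodic_complexity[OF z])
  then show False using unb[of "p + length z"] by (meson not_le)
qed

lemma extension_factor:
  assumes "x p = c" "\<And>i. i < length l \<Longrightarrow> x (Suc p + i) = l ! i"
  shows "c # l \<in> factors (Suc (length l)) x"
proof -
  have "c # l = factor_at x (Suc (length l)) p"
    using assms by (intro nth_equalityI) (auto simp: subsequence_def nth_Cons simp del: upt_Suc split: nat.split)
  then show ?thesis by (auto simp: factors_def)
qed

text \<open>Both changes between \<open>u\<close> and \<open>v\<close> occur anyway. If
  \<open>u u\<close> and \<open>v v\<close> occur as well, then \<open>b\<close> preceded by the
  last letter of \<open>u\<close>, and \<open>b\<close> preceded by that of \<open>v\<close>, both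
  have two continuations: two right special factors of the same length. A nonempty \<open>w\<close>
  in front of \<open>u\<close> counts as the end of an earlier \<open>u\<close>.\<close>

lemma coded_not_both:
  assumes fr: "is_frame (u, v, w, b)" and co: "coded x w u v y"
    and nc: "\<And>k c. \<exists>i\<ge>k. y i \<noteq> c"
    and rs: "\<And>f g. f \<in> right_special (Suc (length b)) x \<Longrightarrow> g \<in> right_special (Suc (length b)) x \<Longrightarrow> f = g"
    and uu: "(\<exists>i. y i \<and> y (Suc i)) \<or> w \<noteq> [] \<and> y 0"
    and vv: "\<exists>i. \<not> y i \<and> \<not> y (Suc i)"
  shows False
proof -
  let ?blk = "\<lambda>c. if c then u else v"
  define next_letter where "next_letter c = (?blk c @ b) ! length b" for c
  define E where "E l c \<longleftrightarrow> l # b @ [next_letter c] \<in> factors (Suc (Suc (length b))) x" for l c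
  have ne: "u \<noteq> []" "v \<noteq> []" using fr by auto
  have after: "x (length (w @ concat (blocks u v y k)) + i) = (b @ [next_letter (y k)]) ! i"
    if i: "i < Suc (length b)" for i k
  proof -
    have "Sublist.prefix b (?blk (y k) @ b)" "?blk (y k) \<noteq> []" using fr by auto
    then have "(?blk (y k) @ b) ! i = (b @ [next_letter (y k)]) ! i"
      using i prefix_nth_eq[of b "?blk (y k) @ b" i]
      by (cases "i = length b") (auto simp: next_letter_def nth_append)
    moreover have "0 < length (?blk (y k))" using ne by auto
    then have "i < length (?blk (y k)) + length b" using i by linarith
    ultimately show ?thesis using coded_at[OF fr co] by metis
  qed
  have E1: "E (last (?blk (y k))) (y (Suc k))" for k
  proof -
    define p where "p = length (w @ concat (blocks u v y k))"
    define q where "q = length (?blk (y k)) - 1"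
    have q: "q < length (?blk (y k))" using ne by (auto simp: q_def)
    have pq: "length (w @ concat (blocks u v y (Suc k))) = Suc (p + q)"
      using ne by (auto simp: blocks_Suc p_def q_def)
    have "x (p + q) = (?blk (y k) @ b) ! q"
      unfolding p_def using coded_at[OF fr co, of q k] q by linarith
    also have "\<dots> = last (?blk (y k))" using ne by (auto simp: q_def nth_append last_conv_nth)
    finally show ?thesis
      unfolding E_def using extension_factor[of x "p + q" _ "b @ [next_letter (y (Suc k))]"]
        after[of _ "Suc k", unfolded pq] by simp
  qed
  have E2: "E (last u) True" if "w \<noteq> []" "y 0"
  proof -
    obtain e where e: "u = e @ w" using fr by (auto simp: Sublist.suffix_def)
    have "starts w x" using co by (auto simp: coded_def dest: starts_append_left)
    then have "x (length w - 1) = last w" using that(1) by (simp add: starts_def last_conv_nth)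
    then have "x (length w - 1) = last u" using that(1) e by simp
    then show ?thesis
      unfolding E_def using extension_factor[of x "length w - 1" _ "b @ [next_letter True]"]
        after[of _ 0] that by (simp add: blocks_def)
  qed
  have Euu: "E (last u) True" using uu E1 E2 by metis
  have Evv: "E (last v) False" using vv E1 by metis
  have ex: "\<exists>i. y i = c \<and> y (Suc i) = (\<not> c)" for c
  proof -
    obtain i where i: "y i = c" using nc[of 0 "\<not> c"] by auto
    obtain j where j: "j \<ge> i" "y j = (\<not> c)" using nc[of i c] by auto
    define l where "l = (LEAST l. l \<ge> i \<and> y l = (\<not> c))"
    have l: "l \<ge> i" "y l = (\<not> c)" using LeastI[of "\<lambda>l. l \<ge> i \<and> y l = (\<not> c)" j] j by (auto simp: l_def)
    then have "l \<noteq> i" using i by auto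
    then have "l \<noteq> 0" using l(1) by auto
    have "y (l - 1) = c"
      using not_less_Least[of "l - 1" "\<lambda>l. l \<ge> i \<and> y l = (\<not> c)"] \<open>l \<noteq> i\<close> \<open>l \<noteq> 0\<close> l by (auto simp: l_def)
    then show ?thesis using l \<open>l \<noteq> 0\<close> by (intro exI[of _ "l - 1"]) auto
  qed
  have Euv: "E (last u) False" using ex[of True] E1 by metis
  have Evu: "E (last v) True" using ex[of False] E1 by metis
  have neq: "next_letter True \<noteq> next_letter False" using fr by (simp add: next_letter_def)
  have "last u # b \<in> right_special (Suc (length b)) x" "last v # b \<in> right_special (Suc (length b)) x"
    unfolding right_special_def mem_Collect_eq
    by (intro exI[of _ "next_letter True"] exI[of _ "next_letter False"];
        use Euu Euv Evu Evv neq in \<open>simp add: E_def\<close>)+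
  from rs[OF this] show False using fr by simp
qed

fun coded_frame :: "'a word \<Rightarrow> 'a frame \<Rightarrow> (nat \<Rightarrow> bool) \<Rightarrow> bool"
  where "coded_frame x (u, v, w, b) y \<longleftrightarrow> coded x w u v y"

lemma coded_next2:
  assumes "coded x w u v y" "\<not> y 0" "\<And>i. y i \<or> y (Suc i)"
  shows "\<exists>y'. coded_frame x (next_frame 2 (u, v, w, b)) y'"
proof -
  have "coded x (w @ v) u v (\<lambda>i. y (Suc i))" using coded_shift[OF assms(1)] assms(2) by simp
  from coded_recode[OF this] assms(2,3) obtain y' where "coded x (w @ v) u (u @ v) y'" by blast
  from coded_swap[OF this] show ?thesis by auto
qed

text \<open>The second alternative is the case of a first block \<open>u\<close> while
  \<open>v v\<close> occurs. Then \<open>u u\<close> is excluded, which forces an empty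
  \<open>w\<close>, and \<open>u\<close> and \<open>v\<close> exchange their roles.\<close>

lemma coded_next:
  assumes fr: "is_frame (u, v, w, b)" and co: "coded x w u v y"
    and unb: "\<And>K. \<exists>n. complexity n x > K"
    and rs: "\<And>f g. f \<in> right_special (Suc (length b)) x \<Longrightarrow> g \<in> right_special (Suc (length b)) x \<Longrightarrow> f = g"
  shows "(\<exists>m\<in>{1, 2, 3}. starts (w @ (if m = 1 then u else v) @ b) x \<and>
      (\<exists>y'. coded_frame x (next_frame m (u, v, w, b)) y'))
    \<or> w = [] \<and> (\<exists>y'. coded_frame x (next_frame 2 (v, u, w, b)) y')"
proof -
  note st = coded_starts[OF fr co]
  have both: False if "(\<exists>i. y i \<and> y (Suc i)) \<or> w \<noteq> [] \<and> y 0" "\<exists>i. \<not> y i \<and> \<not> y (Suc i)"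
    using coded_not_both[OF fr co coded_not_constant[OF fr co unb] rs that] by blast
  consider "y 0" "\<And>i. y i \<or> y (Suc i)" | "y 0" "\<exists>i. \<not> y i \<and> \<not> y (Suc i)"
    | "\<not> y 0" "\<And>i. y i \<or> y (Suc i)" | "\<not> y 0" "\<exists>i. \<not> y i \<and> \<not> y (Suc i)"
    by blast
  then show ?thesis
  proof cases
    case 1
    then have "\<exists>y'. coded_frame x (next_frame 1 (u, v, w, b)) y'" using coded_recode[OF co] by simp
    then show ?thesis using st 1 by (intro disjI1 bexI[of _ 1]) auto
  next
    case 2
    then have w: "w = []" and "\<And>i. \<not> y i \<or> \<not> y (Suc i)" using both by blast+
    then have "\<exists>y'. coded_frame x (next_frame 2 (v, u, w, b)) y'"
      using coded_next2[OF coded_swap[OF co]] 2(1) by simp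
    then show ?thesis using w by (intro disjI2 conjI)
  next
    case 3
    then have "\<exists>y'. coded_frame x (next_frame 2 (u, v, w, b)) y'" using coded_next2[OF co] by blast
    then show ?thesis using st 3 by (intro disjI1 bexI[of _ 2]) auto
  next
    case 4
    then have "\<And>i. \<not> y i \<or> \<not> y (Suc i)" using both by blast
    from coded_recode[OF coded_swap[OF co] _ this] 4 obtain y' where "coded x w v (v @ u) y'" by auto
    from coded_swap[OF this] have "\<exists>y'. coded_frame x (next_frame 3 (u, v, w, b)) y'" by auto
    then show ?thesis using st 4 by (intro disjI1 bexI[of _ 3]) auto
  qed
qed

lemma Sturmian_complexity: "x \<in> Sturmian \<Longrightarrow> n \<ge> 1 \<Longrightarrow> complexity n x = n + 1"
  by (simp add: Sturmian_def)

lemma Sturmian_right_special: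
  assumes "x \<in> Sturmian" "n \<ge> 1" "f \<in> right_special n x" "g \<in> right_special n x"
  shows "f = g"
proof (rule ccontr)
  assume "f \<noteq> g"
  have c: "card (factors n x) = n + 1" "card (factors (Suc n) x) = n + 2"
    using assms Sturmian_complexity[of x n] Sturmian_complexity[of x "Suc n"] by (simp_all add: complexity_def)
  then have "finite (factors n x)" "finite (factors (Suc n) x)" by (auto intro: card_ge_0_finite)
  then have "card (factors n x) + card {f, g} \<le> card (factors (Suc n) x)"
    using assms(3,4) by (intro card_factors_right_special) auto
  with c \<open>f \<noteq> g\<close> show False by simp
qed

text \<open>An exchange of \<open>u\<close> and \<open>v\<close> requires an empty initial part and
  produces a nonempty one, which no move empties again. Hence at most one exchange occurs, and the
  frames after it form a directed sequence.\<close>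

lemma Sturmian_directed:
  assumes x: "x \<in> Sturmian"
  shows "\<exists>F m. directed x F m"
proof -
  define P where "P s \<longleftrightarrow> is_frame (fst s) \<and> coded_frame x (fst s) (snd s)" for s :: "nat frame \<times> (nat \<Rightarrow> bool)"
  define R where "R m F G \<longleftrightarrow> (case F of (u, v, w, b) \<Rightarrow>
    m \<in> {1, 2, 3} \<and> starts (w @ (if m = 1 then u else v) @ b) x \<and> G = next_frame m F)" for m :: nat and F G
  define Q where "Q s t \<longleftrightarrow> (\<exists>m. R m (fst s) (fst t)) \<or>
    (case fst s of (u, v, w, b) \<Rightarrow> w = [] \<and> fst t = next_frame 2 (v, u, w, b))"
    for s t :: "nat frame \<times> (nat \<Rightarrow> bool)"
  have unb: "\<exists>n. complexity n x > K" for K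
    using Sturmian_complexity[OF x, of "Suc K"] by (intro exI[of _ "Suc K"]) auto
  have "\<exists>f. \<forall>n. P (f n) \<and> Q (f n) (f (Suc n))"
  proof (rule dependent_nat_choice)
    \<comment> \<open>The initial frame: the letters are the return words of the empty word.\<close>
    have "concat (blocks [0] [1] (\<lambda>i. x i = 0) k) = map x [0..<k]" for k
    proof (induction k)
      case (Suc k)
      have "x k \<in> {0, 1}" using x by (auto simp: Sturmian_def)
      then show ?case using Suc by (auto simp: blocks_Suc)
    qed (simp add: blocks_def)
    then have "P (([0], [1], [], []), \<lambda>i. x i = 0)"
      by (auto simp: P_def coded_def starts_def)
    then show "\<exists>s. P s" by blast
  next
    fix s n assume P: "P s"
    obtain u v w b y where s: "s = ((u, v, w, b), y)" by (metis surj_pair)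
    have fr: "is_frame (u, v, w, b)" and co: "coded x w u v y" using P by (auto simp: P_def s simp del: is_frame.simps)
    have rs: "f = g" if "f \<in> right_special (Suc (length b)) x" "g \<in> right_special (Suc (length b)) x" for f g
      using Sturmian_right_special[OF x _ that] by simp
    from coded_next[OF fr co unb rs]
    consider m y' where "m \<in> {1, 2, 3}" "starts (w @ (if m = 1 then u else v) @ b) x"
        "coded_frame x (next_frame m (u, v, w, b)) y'"
      | y' where "w = []" "coded_frame x (next_frame 2 (v, u, w, b)) y'" by blast
    then show "\<exists>t. P t \<and> Q s t"
    proof cases
      case (1 m y')
      have "R m (u, v, w, b) (next_frame m (u, v, w, b))"
        using 1 unfolding R_def by (simp del: next_frame.simps)
      then have "Q s (next_frame m (u, v, w, b), y')" unfolding Q_def s fst_conv by blast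
      moreover have "P (next_frame m (u, v, w, b), y')"
        using 1 is_frame_next[OF fr] unfolding P_def by simp
      ultimately show ?thesis by blast
    next
      case (2 y')
      have "is_frame (v, u, w, b)" using is_frame_swap fr 2 by blast
      then show ?thesis using 2 is_frame_next
        by (intro exI[of _ "(next_frame 2 (v, u, w, b), y')"])
          (auto simp: P_def Q_def R_def s simp del: next_frame.simps is_frame.simps)
    qed
  qed
  then obtain f where f: "\<And>n. P (f n)" "\<And>n. Q (f n) (f (Suc n))" by blast
  define w where "w n = (case fst (f n) of (u, v, w, b) \<Rightarrow> w)" for n
  have w_step: "w (Suc n) \<noteq> []" if "w n \<noteq> []" for n
    using f(2)[of n] that unfolding Q_def R_def w_def
    by (auto split: prod.splits if_splits)
  have w_mono: "w (n + i) \<noteq> []" if "w n \<noteq> []" for n i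
    by (induction i) (use that w_step in auto)
  have "\<exists>n. \<forall>i\<ge>n. \<exists>m. R m (fst (f i)) (fst (f (Suc i)))"
  proof (cases "\<exists>n. w n \<noteq> []")
    case True
    then obtain n where n: "w n \<noteq> []" by blast
    have "\<exists>m. R m (fst (f i)) (fst (f (Suc i)))" if "i \<ge> n" for i
      using f(2)[of i] w_mono[OF n, of "i - n"] that unfolding Q_def w_def by (auto split: prod.splits)
    then show ?thesis by blast
  next
    case False
    have "\<exists>m. R m (fst (f i)) (fst (f (Suc i)))" for i
    proof (rule ccontr)
      assume no: "\<not> ?thesis"
      obtain u v w' b y where s: "f i = ((u, v, w', b), y)" by (metis surj_pair)
      then have "u \<noteq> []" using f(1)[of i] by (simp add: P_def)
      moreover have "fst (f (Suc i)) = next_frame 2 (v, u, w', b)" using f(2)[of i] no unfolding Q_def s by auto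
      ultimately have "w (Suc i) \<noteq> []" by (simp add: w_def)
      then show False using False by blast
    qed
    then show ?thesis by blast
  qed
  then obtain n where "\<forall>i\<ge>n. \<exists>m. R m (fst (f i)) (fst (f (Suc i)))" by blast
  then have "\<forall>i. \<exists>m. R m (fst (f (n + i))) (fst (f (Suc (n + i))))" by auto
  then obtain m where m: "\<And>i. R (m i) (fst (f (n + i))) (fst (f (Suc (n + i))))" by metis
  have "directed x (\<lambda>i. fst (f (n + i))) m"
    unfolding directed_def
  proof
    fix j
    obtain u v w' b y where s: "f (n + j) = ((u, v, w', b), y)" by (metis surj_pair)
    have fr: "is_frame (u, v, w', b)" and co: "coded x w' u v y"
      using f(1)[of "n + j"] by (auto simp: P_def s simp del: is_frame.simps)
    show "is_frame (fst (f (n + j))) \<and> tiled x (fst (f (n + j))) \<and> m j \<in> {1, 2, 3} \<and>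
      fst (f (n + Suc j)) = next_frame (m j) (fst (f (n + j))) \<and>
      (case fst (f (n + j)) of (u, v, w, b) \<Rightarrow> starts (w @ (if m j = 1 then u else v) @ b) x)"
      using m[of j] fr coded_tiled[OF co fr] unfolding R_def
      by (simp add: s del: next_frame.simps is_frame.simps tiled.simps)
  qed
  then show ?thesis by blast
qed

section \<open>Realising a sequence of moves\<close>

lemma limit_word:
  fixes W :: "nat \<Rightarrow> 'a list"
  assumes "\<And>j. Sublist.prefix (W j) (W (Suc j))"
  shows "\<exists>x. \<forall>j. starts (W j) x"
proof -
  have mono: "Sublist.prefix (W i) (W j)" if "i \<le> j" for i j
    using that by (induction j rule: dec_induct) (use assms prefix_order.trans in blast)+
  define x where "x n = W (LEAST j. n < length (W j)) ! n" for n
  have "x i = W j ! i" if "i < length (W j)" for i j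
  proof -
    let ?l = "LEAST j. i < length (W j)"
    have "i < length (W ?l)" using LeastI[of "\<lambda>j. i < length (W j)"] that by blast
    moreover have "?l \<le> j" using Least_le[of "\<lambda>j. i < length (W j)"] that by blast
    ultimately show ?thesis using prefix_nth_eq[OF mono] by (simp add: x_def)
  qed
  then show ?thesis by (auto simp: starts_def)
qed

section \<open>Frames as products of tiles of earlier frames\<close>

fun frame_words :: "'a frame \<Rightarrow> 'a list set"
  where "frame_words (u, v, w, b) = {u, v}"

fun frame_start :: "'a frame \<Rightarrow> 'a list"
  where "frame_start (u, v, w, b) = w"

fun bispecial :: "'a frame \<Rightarrow> 'a list"
  where "bispecial (u, v, w, b) = b"

definition tiles :: "'a frame \<Rightarrow> 'a list set"
  where "tiles F = concat ` lists (frame_words F)"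

lemma tiles_append: "k \<in> tiles F \<Longrightarrow> l \<in> tiles F \<Longrightarrow> k @ l \<in> tiles F"
proof -
  assume "k \<in> tiles F" "l \<in> tiles F"
  then obtain ks ls where "ks \<in> lists (frame_words F)" "ls \<in> lists (frame_words F)"
    "k = concat ks" "l = concat ls" by (auto simp: tiles_def)
  then show "k @ l \<in> tiles F" unfolding tiles_def by (intro image_eqI[of _ _ "ks @ ls"]) simp_all
qed

lemma frame_words_tiles: "frame_words F \<subseteq> tiles F"
proof
  fix z assume "z \<in> frame_words F"
  then have "concat [z] \<in> tiles F" unfolding tiles_def by (intro imageI) auto
  then show "z \<in> tiles F" by simp
qed

lemma Nil_tiles: "[] \<in> tiles F"
  unfolding tiles_def by (rule image_eqI[of _ _ "[]"]) auto

text \<open>This makes the initial parts a chain of prefixes with a limit word, and it makes the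
  limit tiled by every frame of the sequence.\<close>

lemma frame_sequence_tiles:
  assumes step: "\<And>j. F (Suc j) = next_frame (m j) (F j)" and jk: "j \<le> k"
  shows "frame_words (F k) \<subseteq> tiles (F j) \<and> (\<exists>t\<in>tiles (F j). frame_start (F k) = frame_start (F j) @ t)"
  using jk
proof (induction k rule: dec_induct)
  case base
  then show ?case using frame_words_tiles Nil_tiles by fastforce
next
  case (step k)
  obtain u v w b where F: "F k = (u, v, w, b)" by (metis surj_pair)
  have uv: "u \<in> tiles (F j)" "v \<in> tiles (F j)" using step by (auto simp: F)
  obtain t where t: "t \<in> tiles (F j)" "w = frame_start (F j) @ t" using step by (auto simp: F)
  have words: "frame_words (F (Suc k)) \<subseteq> {u, v, u @ v, v @ u}"
    and start: "frame_start (F (Suc k)) \<in> {w, w @ v}"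
    by (auto simp: F assms(1))
  have sub: "{u, v, u @ v, v @ u} \<subseteq> tiles (F j)" using uv tiles_append[OF uv] tiles_append[OF uv(2,1)] by simp
  have tv: "t @ v \<in> tiles (F j)" using tiles_append[OF t(1) uv(2)] .
  have "\<exists>t'\<in>tiles (F j). frame_start (F (Suc k)) = frame_start (F j) @ t'"
  proof (cases "frame_start (F (Suc k)) = w")
    case True
    then show ?thesis using t by auto
  next
    case False
    then show ?thesis using start tv t by (intro bexI[of _ "t @ v"]) auto
  qed
  then show ?case using order.trans[OF words sub] by (rule conjI[rotated])
qed

section \<open>The Sturmian word of a sequence of moves 2 and 3\<close>

context
  fixes m :: "nat \<Rightarrow> nat" and F :: "nat \<Rightarrow> nat frame"
  assumes moves: "\<And>j. m j = 2 \<or> m j = 3" "\<And>j. m j = 3 \<Longrightarrow> m (Suc j) = 2"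
    and F0: "F 0 = ([0], [1], [], [])" and FSuc: "\<And>j. F (Suc j) = next_frame (m j) (F j)"
begin

lemma is_frame_F: "is_frame (F j)"
  by (induction j) (simp add: F0, simp add: FSuc is_frame_next del: is_frame.simps next_frame.simps)

lemma letters_F: "F j = (u, v, w, b) \<Longrightarrow> set u \<union> set v \<union> set w \<subseteq> {0, 1}"
proof (induction j arbitrary: u v w b)
  case 0
  then show ?case by (auto simp: F0)
next
  case (Suc j)
  obtain u1 v1 w1 b1 where F: "F j = (u1, v1, w1, b1)" by (metis surj_pair)
  show ?case using Suc.prems Suc.IH[OF F] by (auto simp: FSuc F split: if_splits)
qed

text \<open>A move 3 changes neither \<open>w\<close> nor \<open>v\<close>, and the move 2 that has
  to follow it appends this \<open>v\<close>.\<close>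

lemma start_append:
  assumes "F j = (u, v, w, b)"
  shows "\<exists>k>j. frame_start (F k) = w @ v"
proof (cases "m j = 2")
  case True
  then show ?thesis using assms by (intro exI[of _ "Suc j"]) (simp add: FSuc)
next
  case False
  then have "m j = 3" "m (Suc j) = 2" using moves by auto
  then show ?thesis using assms by (intro exI[of _ "Suc (Suc j)"]) (simp add: FSuc)
qed

lemma frame_start_unbounded: "\<exists>k. L \<le> length (frame_start (F k))"
proof (induction L)
  case (Suc L)
  then obtain k where k: "L \<le> length (frame_start (F k))" by blast
  obtain u v w b where F: "F k = (u, v, w, b)" by (metis surj_pair)
  obtain l where "frame_start (F l) = w @ v" using start_append[OF F] by blast
  moreover have "v \<noteq> []" using is_frame_F[of k] by (simp add: F)
  ultimately have "Suc L \<le> length (frame_start (F l))" using k by (cases v) (auto simp: F)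
  then show ?case by blast
qed simp

lemma bispecial_length: "j \<le> length (bispecial (F j))"
proof (induction j)
  case (Suc j)
  obtain u v w b where F: "F j = (u, v, w, b)" by (metis surj_pair)
  have "length (bispecial (F (Suc j))) > length b" using is_frame_F[of j] by (auto simp: FSuc F)
  then show ?case using Suc by (simp add: F)
qed simp

context
  fixes x :: "nat word"
  assumes x: "\<And>j. starts (frame_start (F j)) x"
begin

lemma starts_tiles:
  "\<exists>t\<in>tiles (F j). L \<le> length t \<and> starts (frame_start (F j) @ t) x"
proof -
  obtain k where k: "L + length (frame_start (F j)) \<le> length (frame_start (F k))"
    using frame_start_unbounded by blast
  obtain t where t: "t \<in> tiles (F j)" "frame_start (F (max j k)) = frame_start (F j) @ t"
    using frame_sequence_tiles[of F m j "max j k"] FSuc by auto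
  obtain t' where "frame_start (F (max j k)) = frame_start (F k) @ t'"
    using frame_sequence_tiles[of F m k "max j k"] FSuc by auto
  then have "length (frame_start (F k)) \<le> length (frame_start (F j) @ t)" unfolding t(2)[symmetric] by simp
  then have "L \<le> length t" using k by simp
  moreover have "starts (frame_start (F j) @ t) x" using x[of "max j k"] unfolding t(2) .
  ultimately show ?thesis using t(1) by blast
qed

lemma tiled_F: "tiled x (F j)"
proof -
  obtain u v w b where F: "F j = (u, v, w, b)" by (metis surj_pair)
  have "\<exists>zs\<in>lists {u, v}. L \<le> length (concat zs) \<and> starts (w @ concat zs) x" for L
  proof -
    obtain t where t: "t \<in> tiles (F j)" "L \<le> length t" "starts (frame_start (F j) @ t) x"
      using starts_tiles by blast
    then obtain zs where "zs \<in> lists {u, v}" "t = concat zs" by (auto simp: tiles_def F)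
    then show ?thesis using t by (intro bexI[of _ zs]) (simp_all add: F)
  qed
  then show ?thesis by (simp add: F)
qed

lemma starts_F: "F j = (u, v, w, b) \<Longrightarrow> starts (w @ v @ b) x"
proof -
  assume F: "F j = (u, v, w, b)"
  obtain k where k: "k > j" "frame_start (F k) = w @ v" using start_append[OF F] by blast
  obtain t where t: "t \<in> tiles (F k)" "length b \<le> length t" "starts (w @ v @ t) x"
    using starts_tiles[of k "length b"] unfolding k(2) append.assoc by blast
  have "tiles (F k) \<subseteq> tiles (F j)"
  proof
    fix s assume "s \<in> tiles (F k)"
    then obtain zs where zs: "zs \<in> lists (frame_words (F k))" "s = concat zs" by (auto simp: tiles_def)
    from zs(1) have "concat zs \<in> tiles (F j)"
    proof induction
      case (Cons z zs)
      have "j \<le> k" using k(1) by simp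
      then have "z \<in> tiles (F j)" using frame_sequence_tiles[of F m j k] FSuc Cons.hyps(1) by blast
      then have "z @ concat zs \<in> tiles (F j)" by (rule tiles_append[OF _ Cons.IH])
      then show ?case by simp
    qed (simp add: Nil_tiles)
    then show "s \<in> tiles (F j)" by (simp add: zs)
  qed
  then have "t \<in> tiles (F j)" using t(1) by blast
  then obtain zs where zs: "zs \<in> lists {u, v}" "t = concat zs" by (auto simp: tiles_def F)
  have "is_frame (u, v, w, b)" using is_frame_F[of j] F by metis
  from starts_tile[OF this zs(1)] t zs(2)
  have at: "x (length w + i) = (v @ b) ! i" if "i < length v + length b" for i using that by blast
  have "x i = (w @ v @ b) ! i" if "i < length (w @ v @ b)" for i
  proof (cases "i < length w")
    case True
    then show ?thesis using starts_nth[OF t(3), of i] by (simp add: nth_append_left)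
  next
    case False
    then have "x (length w + (i - length w)) = (v @ b) ! (i - length w)" using that by (intro at) auto
    then show ?thesis using False by (simp add: nth_append_right)
  qed
  then show ?thesis by (simp add: starts_def)
qed

text \<open>The word \<open>v @ b\<close> occurs directly after \<open>w\<close>. The word
  \<open>u @ b\<close> is found inside the corresponding word \<open>v' @ b'\<close> of a later
  frame, one move 2 or the two moves 3, 2 ahead.\<close>

lemma occurs_F:
  assumes F: "F j = (u, v, w, b)" and z: "z \<in> {u, v}"
  shows "\<exists>p. \<forall>i<length z + length b. x (p + i) = (z @ b) ! i"
proof (cases "z = v")
  case True
  then show ?thesis using starts_nth[OF starts_F[OF F]]
    by (intro exI[of _ "length w"]) auto
next
  case False
  then have zu: "z = u" using z by auto
  have "\<exists>k u' v' w' b' e r. F k = (u', v', w', b') \<and> v' @ b' = e @ u @ b @ r"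
  proof (cases "m j = 2")
    case True
    then have "F (Suc j) = (u @ v, u, w @ v, u @ b)" using F by (simp add: FSuc)
    moreover have "u @ (u @ b) = u @ u @ b @ []" by simp
    ultimately show ?thesis by blast
  next
    case False
    then have "m j = 3" "m (Suc j) = 2" using moves by auto
    then have "F (Suc (Suc j)) = ((v @ u) @ v, v @ u, w @ v, (v @ u) @ (v @ b))" using F by (simp add: FSuc)
    moreover obtain r where "v @ b = b @ r" using is_frame_F[of j] F by (auto simp: Sublist.prefix_def)
    then have "(v @ u) @ ((v @ u) @ (v @ b)) = (v @ u @ v) @ u @ b @ r" by simp
    ultimately show ?thesis by blast
  qed
  then obtain k u' v' w' b' e r where k: "F k = (u', v', w', b')" "v' @ b' = e @ u @ b @ r"
    by blast
  have "starts ((w' @ e) @ (u @ b) @ r) x" using starts_F[OF k(1)] k(2) by simp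
  then have "x (length (w' @ e) + i) = (u @ b) ! i" if "i < length u + length b" for i
    using starts_nth[of "(w' @ e) @ (u @ b) @ r" x "length (w' @ e) + i"] that
    by (simp only: nth_append_length_plus) (simp add: nth_append_left del: append_assoc)
  then show ?thesis unfolding zu by blast
qed

text \<open>Both \<open>u @ b\<close> and \<open>v @ b\<close> occur, so each suffix of
  \<open>b\<close> is followed by two letters, and \<open>b\<close> can be chosen arbitrarily
  long.\<close>

lemma right_special_F: "right_special n x \<noteq> {}"
proof -
  obtain u v w b where F: "F n = (u, v, w, b)" by (metis surj_pair)
  have n: "n \<le> length b" using bispecial_length[of n] F by simp
  have fr: "is_frame (u, v, w, b)" using is_frame_F[of n] F by metis
  let ?f = "drop (length b - n) b"
  have "?f @ [(z @ b) ! length b] \<in> factors (Suc n) x" if z: "z \<in> {u, v}" for z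
  proof -
    obtain p where p: "\<And>i. i < length z + length b \<Longrightarrow> x (p + i) = (z @ b) ! i"
      using occurs_F[OF F z] by blast
    have pre: "Sublist.prefix b (z @ b)" "0 < length z" using fr z by auto
    have "?f @ [(z @ b) ! length b] = factor_at x (Suc n) (p + (length b - n))"
    proof (rule nth_equalityI)
      fix i assume "i < length (?f @ [(z @ b) ! length b])"
      then have i: "i \<le> n" using n by simp
      have "x (p + (length b - n + i)) = (z @ b) ! (length b - n + i)" using i n pre(2) by (intro p) linarith
      also have "\<dots> = (?f @ [(z @ b) ! length b]) ! i"
        using i n prefix_nth_eq[OF pre(1)] by (cases "i = n") (auto simp: nth_append)
      finally show "(?f @ [(z @ b) ! length b]) ! i = factor_at x (Suc n) (p + (length b - n)) ! i"
        using i by (simp add: subsequence_def ac_simps del: upt_Suc)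
    qed (use n in \<open>simp add: subsequence_def\<close>)
    then show ?thesis unfolding factors_def by blast
  qed
  moreover have "(u @ b) ! length b \<noteq> (v @ b) ! length b" using fr by simp
  ultimately show ?thesis unfolding right_special_def by blast
qed

text \<open>Right special factors of every length make the complexity grow by at least 1 in each
  step, while the frames bound it by |b| + 1 at arbitrarily large lengths |b|. So it grows by
  exactly 1.\<close>

lemma Sturmian_limit: "x \<in> Sturmian"
proof -
  have letters: "x i \<in> {0, 1}" for i
  proof -
    obtain k where k: "Suc i \<le> length (frame_start (F k))" using frame_start_unbounded by blast
    obtain u v w b where F: "F k = (u, v, w, b)" by (metis surj_pair)
    have "x i = w ! i" "i < length w" using starts_nth[OF x[of k], of i] k F by auto
    then have "x i \<in> set w" by simp
    then show ?thesis using letters_F[OF F] by blast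
  qed
  have fin: "finite (factors n x)" for n
  proof (rule finite_subset)
    have "range x \<subseteq> {0, 1}" by (intro image_subsetI letters)
    then have sub: "set (factor_at x n i) \<subseteq> {0, 1}" for i
      by (rule order.trans[rotated]) (auto simp: subsequence_def)
    show "factors n x \<subseteq> {l. set l \<subseteq> {0, 1} \<and> length l = n}"
    proof
      fix l assume "l \<in> factors n x"
      then obtain i where "l = factor_at x n i" by (auto simp: factors_def)
      then show "l \<in> {l. set l \<subseteq> {0, 1} \<and> length l = n}"
        using sub[of i] by (intro CollectI conjI) (simp only:, simp)
    qed
    show "finite {l :: nat list. set l \<subseteq> {0, 1} \<and> length l = n}" by (rule finite_lists_length_eq) simp
  qed
  have step: "complexity n x + 1 \<le> complexity (Suc n) x" for n
  proof -
    obtain f where "f \<in> right_special n x" using right_special_F by blast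
    then show ?thesis using card_factors_right_special[of "{f}" n x] fin by (simp add: complexity_def)
  qed
  have "factors 0 x = {[]}" by (auto simp: factors_def subsequence_def)
  then have "complexity 0 x = 1" by (simp add: complexity_def)
  then have ge: "complexity n x \<ge> n + 1" for n
    by (induction n) (use step in \<open>auto intro: order.trans\<close>)
  have "complexity n x = n + 1" for n
  proof -
    obtain u v w b where F: "F n = (u, v, w, b)" by (metis surj_pair)
    have "complexity (length b) x \<le> length b + 1"
      using complexity_le is_frame_F[of n] tiled_F[of n] F by metis
    moreover have "complexity n x + (length b - n) \<le> complexity (length b) x"
    proof -
      have "complexity n x + i \<le> complexity (n + i) x" for i
        by (induction i) (use step in \<open>auto intro: order.trans\<close>)
      from this[of "length b - n"] show ?thesis using bispecial_length[of n] F by simp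
    qed
    ultimately show ?thesis using ge[of n] bispecial_length[of n] F by simp
  qed
  moreover have "range x \<subseteq> {0, 1}" by (intro image_subsetI letters)
  ultimately show ?thesis by (simp add: Sturmian_def)
qed

lemma directed_limit: "directed x F m"
  unfolding directed_def
proof
  fix j
  obtain u v w b where F: "F j = (u, v, w, b)" by (metis surj_pair)
  show "is_frame (F j) \<and> tiled x (F j) \<and> m j \<in> {1, 2, 3} \<and> F (Suc j) = next_frame (m j) (F j) \<and>
    (case F j of (u, v, w, b) \<Rightarrow> starts (w @ (if m j = 1 then u else v) @ b) x)"
    using is_frame_F[of j] tiled_F[of j] moves(1)[of j] starts_F[OF F] FSuc[of j]
    by (auto simp: F simp del: is_frame.simps tiled.simps next_frame.simps)
qed

end

end

lemma realise_moves:
  assumes "\<And>j. m j = 2 \<or> m j = 3" "\<And>j. m j = 3 \<Longrightarrow> m (Suc j) = 2"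
  shows "\<exists>x\<in>Sturmian. \<exists>F. directed x F m"
proof -
  define F :: "nat \<Rightarrow> nat frame" where "F = rec_nat ([0], [1], [], []) (\<lambda>j. next_frame (m j))"
  have F: "F 0 = ([0], [1], [], [])" "\<And>j. F (Suc j) = next_frame (m j) (F j)" by (simp_all add: F_def)
  have "Sublist.prefix (frame_start (F j)) (frame_start (F (Suc j)))" for j
    using frame_sequence_tiles[of F m j "Suc j"] F(2) by (auto simp: Sublist.prefix_def)
  from limit_word[of "\<lambda>j. frame_start (F j)", OF this] obtain x where x: "\<And>j. starts (frame_start (F j)) x" by blast
  show ?thesis
  proof (intro bexI exI)
    show "directed x F m" by (rule directed_limit[OF assms F x])
    show "x \<in> Sturmian" by (rule Sturmian_limit[OF assms F x])
  qed
qed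

section \<open>The exponent of repetition in terms of the moves\<close>

definition orbit :: "(nat \<Rightarrow> nat) \<Rightarrow> (nat \<Rightarrow> real) \<Rightarrow> (nat \<Rightarrow> real) \<Rightarrow> (nat \<Rightarrow> real) \<Rightarrow> bool"
  where "orbit m A C D \<longleftrightarrow> (\<forall>j. m j \<in> {1, 2, 3} \<and> 1 \<le> A j \<and> 1 \<le> C j \<and> 0 \<le> D j \<and> D j \<le> A j \<and>
    (m j = 1 \<longrightarrow> A (Suc j) = A j \<and> C (Suc j) = A j + C j \<and> D (Suc j) = D j) \<and>
    (m j = 2 \<longrightarrow> A (Suc j) = A j + C j \<and> C (Suc j) = A j \<and> D (Suc j) = D j + C j) \<and>
    (m j = 3 \<longrightarrow> A (Suc j) = A j + C j \<and> C (Suc j) = C j \<and> D (Suc j) = D j))"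

text \<open>The critical values of n are a + c - 2 = |b| and, for moves 2 and 3, also d + c - 2. The
  constant 2 is dropped, as it is negligible in the limit; products replace the quotients to keep
  the conditions linear.\<close>

definition good :: "real \<Rightarrow> nat \<Rightarrow> real \<Rightarrow> real \<Rightarrow> real \<Rightarrow> bool"
  where "good t k a c d \<longleftrightarrow>
    (if k = 1 then t * (a + c) < a else t * (a + c) < d + c \<and> t * (d + c) < a)"

lemma orbit_sum_ge: "orbit m A C D \<Longrightarrow> real j \<le> A j + C j"
proof (induction j)
  case (Suc j)
  have "m j \<in> {1, 2, 3}" "1 \<le> A j" "1 \<le> C j" using Suc.prems unfolding orbit_def by blast+
  moreover have "A (Suc j) + C (Suc j) \<ge> A j + C j + 1"
    using Suc.prems calculation unfolding orbit_def by (smt (verit) insertE singletonD)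
  ultimately show ?case using Suc by simp
qed (smt (verit) orbit_def of_nat_0)

lemma orbit_shift: "orbit m A C D \<Longrightarrow> orbit (\<lambda>j. m (n + j)) (\<lambda>j. A (n + j)) (\<lambda>j. C (n + j)) (\<lambda>j. D (n + j))"
  by (simp add: orbit_def)

fun size_u :: "'a frame \<Rightarrow> real" where "size_u (u, v, w, b) = real (length u)"
fun size_v :: "'a frame \<Rightarrow> real" where "size_v (u, v, w, b) = real (length v)"
fun size_w :: "'a frame \<Rightarrow> real" where "size_w (u, v, w, b) = real (length w)"

lemma directed_orbit:
  assumes "directed x F m"
  shows "orbit m (\<lambda>j. size_u (F j)) (\<lambda>j. size_v (F j)) (\<lambda>j. size_w (F j))"
  unfolding orbit_def
proof (rule allI)
  fix j
  obtain u v w b where F: "F j = (u, v, w, b)" by (metis surj_pair)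
  have "is_frame (F j)" "m j \<in> {1, 2, 3}" "F (Suc j) = next_frame (m j) (F j)"
    using assms unfolding directed_def by blast+
  moreover have "1 \<le> real (length u)" "1 \<le> real (length v)" "real (length w) \<le> real (length u)"
    using calculation(1) by (auto simp: F Suc_le_eq dest: suffix_length_le)
  ultimately show "m j \<in> {1, 2, 3} \<and> 1 \<le> size_u (F j) \<and> 1 \<le> size_v (F j) \<and> 0 \<le> size_w (F j) \<and> size_w (F j) \<le> size_u (F j) \<and>
    (m j = 1 \<longrightarrow> size_u (F (Suc j)) = size_u (F j) \<and> size_v (F (Suc j)) = size_u (F j) + size_v (F j) \<and> size_w (F (Suc j)) = size_w (F j)) \<and>
    (m j = 2 \<longrightarrow> size_u (F (Suc j)) = size_u (F j) + size_v (F j) \<and> size_v (F (Suc j)) = size_u (F j) \<and> size_w (F (Suc j)) = size_w (F j) + size_v (F j)) \<and>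
    (m j = 3 \<longrightarrow> size_u (F (Suc j)) = size_u (F j) + size_v (F j) \<and> size_v (F (Suc j)) = size_v (F j) \<and> size_w (F (Suc j)) = size_w (F j))"
    by (auto simp: F)
qed

text \<open>The slack between \<open>t\<close> and \<open>t'\<close> will pay for the constants
  dropped in \<open>good\<close>.\<close>

lemma rep_gtD:
  assumes "ereal (1 + t) < rep x"
  shows "\<exists>t'>t. \<exists>N. \<forall>n\<ge>N. n \<ge> 1 \<longrightarrow> (1 + t') * real n < real (rep_fun n x)"
proof -
  obtain z where z: "ereal (1 + t) < ereal z" "ereal z < rep x" using ereal_dense2[OF assms] by blast
  have "eventually (\<lambda>n. ereal z < ereal (real (rep_fun n x) / real n)) sequentially"
    using less_LiminfD[OF z(2)[unfolded rep_def]] .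
  then obtain N where N: "\<And>n. n \<ge> N \<Longrightarrow> z < real (rep_fun n x) / real n"
    by (auto simp: eventually_sequentially)
  show ?thesis
  proof (intro exI[of _ "z - 1"] exI[of _ N] conjI allI impI)
    show "t < z - 1" using z(1) by simp
    fix n :: nat assume "n \<ge> N" "n \<ge> 1"
    then show "(1 + (z - 1)) * real n < real (rep_fun n x)" using N[of n] by (simp add: field_simps)
  qed
qed

lemma directed_good:
  assumes dir: "directed x F m" and t: "0 < t" and rep: "ereal (1 + t) < rep x"
  shows "\<exists>J. \<forall>j\<ge>J. good t (m j) (size_u (F j)) (size_v (F j)) (size_w (F j))"
proof -
  from rep_gtD[OF rep] obtain t' N where t': "t < t'"
    and N: "\<And>n. n \<ge> N \<Longrightarrow> n \<ge> 1 \<Longrightarrow> (1 + t') * real n < real (rep_fun n x)"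
    by blast
  \<comment> \<open>The first bound gives \<open>t * s \<le> t' * (s - 2)\<close> for all s \<ge> K,
    the second puts the critical lengths beyond N. The quotient \<open>K / t\<close> in
    \<open>J\<close> serves |w| + |v|, which is known to be large only through |w| + |v| > t (|u| +
    |v|) \<ge> t j.\<close>
  define K where "K = max (2 * t' / (t' - t)) (real N + 3)"
  define J where "J = nat \<lceil>max K (K / t)\<rceil>"
  have J: "K \<le> real j" "K \<le> t * real j" if "j \<ge> J" for j
  proof -
    have "max K (K / t) \<le> real j" using that unfolding J_def by linarith
    then show "K \<le> real j" "K \<le> t * real j" using t by (simp_all add: field_simps)
  qed
  have big: "t * s \<le> t' * (s - 2)" if "K \<le> s" for s
  proof -
    have "2 * t' / (t' - t) \<le> s" using that by (simp add: K_def)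
    then show ?thesis using t' by (simp add: field_simps)
  qed
  have "good t (m j) (size_u (F j)) (size_v (F j)) (size_w (F j))" if j: "j \<ge> J" for j
  proof -
    obtain u v w b where F: "F j = (u, v, w, b)" by (metis surj_pair)
    have fr: "is_frame (u, v, w, b)" and st: "starts (w @ (if m j = 1 then u else v) @ b) x"
      using dir[unfolded directed_def, rule_format, of j] by (simp_all only: F case_prod_conv)
    have lb: "length b + 2 = length u + length v" using fr by simp
    then have rb: "real (length b) = real (length u) + real (length v) - 2" by linarith
    have sum: "real j \<le> real (length u) + real (length v)"
      using orbit_sum_ge[OF directed_orbit[OF dir], of j] by (simp add: F)
    then have Ks: "K \<le> real (length u) + real (length v)" using J(1)[OF j] by linarith
    then have "real N + 3 \<le> real (length b) + 2" unfolding rb by (simp add: K_def)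
    then have "N \<le> length b" "1 \<le> length b" by linarith+
    note Nb = N[OF this]
    show ?thesis
    proof (cases "m j = 1")
      case True
      have "real (rep_fun (length b) x) \<le> real (length u) + real (length b)"
        using rep_fun_le_same[OF fr, of x] st True by simp
      then have "t' * real (length b) < real (length u)" using Nb by (simp add: algebra_simps)
      then show ?thesis using big[OF Ks] True unfolding rb good_def F by simp
    next
      case False
      have stv: "starts (w @ v @ b) x" using st False by simp
      have "real (rep_fun (length b) x) \<le> real (length w) + real (length v) + real (length b)"
        using rep_fun_le_return[OF fr stv] by simp
      then have "t' * real (length b) < real (length w) + real (length v)" using Nb by (simp add: algebra_simps)
      then have 1: "t * (real (length u) + real (length v)) < real (length w) + real (length v)"
        using big[OF Ks] unfolding rb by simp
      have "t * real j \<le> t * (real (length u) + real (length v))" using sum t by simp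
      then have Kw: "K \<le> real (length w) + real (length v)" using 1 J(2)[OF j] by linarith
      then have "real N + 3 \<le> real (length w) + real (length v)" by (simp add: K_def)
      then have "N + 3 \<le> length w + length v" by linarith
      moreover define n where "n = length w + length v - 2"
      ultimately have n: "n + 2 = length w + length v" "N \<le> n" "1 \<le> n" by simp_all
      have "real (rep_fun n x) \<le> real (length u) + real n"
        using rep_fun_le_period[OF fr stv n(1)] by simp
      then have "t' * real n < real (length u)" using N[OF n(2,3)] by (simp add: algebra_simps)
      moreover have "real n = real (length w) + real (length v) - 2" using n(1) by linarith
      ultimately have "t * (real (length w) + real (length v)) < real (length u)" using big[OF Kw] by simp
      then show ?thesis using 1 False by (simp add: good_def F)
    qed
  qed
  then show ?thesis by blast
qed

lemma rep_geI:
  assumes "\<And>n. n \<ge> N \<Longrightarrow> (1 + t) * real n \<le> real (rep_fun n x)"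
  shows "ereal (1 + t) \<le> rep x"
  unfolding rep_def
proof (rule Liminf_bounded)
  have "1 + t \<le> real (rep_fun n x) / real n" if "n \<ge> max N 1" for n
    using assms[of n] that by (simp add: field_simps)
  then show "\<forall>\<^sub>F n in sequentially. ereal (1 + t) \<le> ereal (real (rep_fun n x) / real n)"
    unfolding eventually_sequentially ereal_less_eq by blast
qed

text \<open>Between two consecutive bispecial lengths the lower bounds for r(n, x) - n are constant
  on two ranges of n. They are tightest at the right ends of these ranges, near |w| + |v| and |u| +
  |v|, which is where \<open>good\<close> applies.\<close>

lemma directed_rep_ge:
  assumes dir: "directed x F m" and x: "x \<in> Sturmian" and t: "0 \<le> t" "t \<le> 1"
    and m: "\<And>j. j \<ge> J \<Longrightarrow> m j \<noteq> 1"
    and good: "\<And>j. j \<ge> J \<Longrightarrow> good t (m j) (size_u (F j)) (size_v (F j)) (size_w (F j))"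
  shows "ereal (1 + t) \<le> rep x"
proof (rule rep_geI)
  fix n assume n: "n \<ge> Suc (length (bispecial (F J)))"
  define k where "k = (LEAST k. n \<le> length (bispecial (F k)))"
  have orb: "orbit m (\<lambda>j. size_u (F j)) (\<lambda>j. size_v (F j)) (\<lambda>j. size_w (F j))" by (rule directed_orbit[OF dir])
  have fr: "is_frame (F j)" and ti: "tiled x (F j)" and step: "F (Suc j) = next_frame (m j) (F j)"
    and mj: "m j \<in> {1, 2, 3}" for j
    using dir unfolding directed_def by blast+
  have len: "j \<le> length (bispecial (F j)) + 2" for j
  proof -
    obtain u v w b where F: "F j = (u, v, w, b)" by (metis surj_pair)
    have "real j \<le> real (length u + length v)" using orbit_sum_ge[OF orb, of j] by (simp add: F)
    moreover have "length u + length v = length b + 2" using fr[of j] by (simp add: F)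
    ultimately show ?thesis by (simp add: F)
  qed
  have mono: "length (bispecial (F j)) \<le> length (bispecial (F (Suc j)))" for j
    by (cases "F j") (simp add: step)
  have k: "n \<le> length (bispecial (F k))"
    using LeastI[of "\<lambda>k. n \<le> length (bispecial (F k))" "n + 2"] len[of "n + 2"]
    unfolding k_def by simp
  have "J < k"
  proof (rule ccontr)
    assume "\<not> J < k"
    then have "k \<le> J" by simp
    with mono have "length (bispecial (F k)) \<le> length (bispecial (F J))"
      by (rule lift_Suc_mono_le[of "\<lambda>j. length (bispecial (F j))"])
    then show False using n k by simp
  qed
  then obtain l where l: "k = Suc l" "J \<le> l" by (cases k) auto
  have nl: "length (bispecial (F l)) < n" using not_less_Least[of l "\<lambda>k. n \<le> length (bispecial (F k))"] l k_def by auto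
  obtain u' v' w' b' where F': "F l = (u', v', w', b')" by (metis surj_pair)
  obtain u v w b where F: "F k = (u, v, w, b)" by (metis surj_pair)
  have "m l = 2 \<or> m l = 3" using mj[of l] m[OF l(2)] by auto
  \<comment> \<open>After move 2 or 3 the word \<open>u\<close> has length |u'| + |v'| = |b'| + 2,
    which is at most n + 1.\<close>
  then have le: "length v \<le> length u" "length u = length b' + 2"
    using step[of l] fr[of l] unfolding l(1)[symmetric] F F' by auto
  have n1: "length u \<le> n + 1" "length v \<le> n + 1" using le nl F' by simp_all
  have frk: "is_frame (u, v, w, b)" and tik: "tiled x (u, v, w, b)" using fr[of k] ti[of k] by (simp_all only: F)
  have mk: "m k \<noteq> 1" using m[of k] l by simp
  have st: "starts (w @ v @ b) x"
    using dir[unfolded directed_def, rule_format, of k] mk by (simp only: F case_prod_conv if_False)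
  have nb: "n \<le> length b" using k F by simp
  have cx: "complexity n x = n + 1" using Sturmian_complexity[OF x] n by simp
  note ge = rep_fun_ge_frame[OF frk tik st nb n1 cx]
  have g: "t * (real (length u) + real (length v)) < real (length w) + real (length v)"
    "t * (real (length w) + real (length v)) < real (length u)"
    using good[of k] l mk unfolding good_def F by auto
  have "length b + 2 = length u + length v" using frk by simp
  then have nr: "real n \<le> real (length u) + real (length v)" using nb by linarith
  \<comment> \<open>Here t \<le> 1 enters: the minimum below may be |w| + |v|, which is at least
    n.\<close>
  have tn: "t * real n \<le> real n" using t by (simp add: mult_left_le_one_le)
  show "(1 + t) * real n \<le> real (rep_fun n x)"
  proof (cases "length w + length v \<le> n + 1")
    case True
    then have "length w + length v + n \<le> rep_fun n x" by (intro ge) auto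
    then have "real (length w) + real (length v) + real n \<le> real (rep_fun n x)" by linarith
    moreover have "t * real n \<le> t * (real (length u) + real (length v))" using t nr by (intro mult_left_mono)
    ultimately show ?thesis using g by (simp add: algebra_simps)
  next
    case False
    then have "min (length u) (length w + length v) + n \<le> rep_fun n x" by (intro ge) auto
    then have 1: "min (real (length u)) (real (length w) + real (length v)) + real n \<le> real (rep_fun n x)" by linarith
    have nw: "real n \<le> real (length w) + real (length v)" using False by linarith
    then have "t * real n \<le> t * (real (length w) + real (length v))" using t by (intro mult_left_mono)
    then have "t * real n \<le> min (real (length u)) (real (length w) + real (length v))" using g tn nw by linarith
    moreover have "(1 + t) * real n = real n + t * real n" by (simp add: algebra_simps)
    ultimately show ?thesis using 1 by linarith
  qed
qed

text \<open>An exponent above 4 would make \<open>good 3\<close> hold eventually, which D \<le> A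
  forbids. The lower bound is the trivial case t = -1.\<close>

lemma Sturmian_rep_real:
  assumes "x \<in> Sturmian" shows "rep x \<in> range ereal"
proof -
  obtain F m where dir: "directed x F m" using Sturmian_directed[OF assms] by blast
  note orb = directed_orbit[OF dir]
  have "\<not> ereal (1 + 3) < rep x"
  proof
    assume "ereal (1 + 3) < rep x"
    from directed_good[OF dir _ this] obtain J where "good 3 (m J) (size_u (F J)) (size_v (F J)) (size_w (F J))" by auto
    moreover have "1 \<le> size_u (F J)" "1 \<le> size_v (F J)" "size_w (F J) \<le> size_u (F J)"
      using orb unfolding orbit_def by blast+
    ultimately show False by (auto simp: good_def split: if_splits)
  qed
  moreover have "ereal 0 \<le> rep x" using rep_geI[of 0 "-1" x] by simp
  ultimately show ?thesis by (cases "rep x") auto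
qed

section \<open>Words of moves with a large exponent\<close>

lemma good_mono:
  assumes "good t k a c d" "t' \<le> t" "0 \<le> a" "0 \<le> c" "0 \<le> d"
  shows "good t' k a c d"
proof -
  have "t' * (a + c) \<le> t * (a + c)" "t' * (d + c) \<le> t * (d + c)"
    using assms by (auto intro!: mult_right_mono)
  then show ?thesis using assms(1) unfolding good_def by (auto split: if_splits)
qed

lemma sqrt10_bounds: "3.1622 < sqrt 10" "sqrt 10 < 3.1623"
  by (rule real_less_rsqrt, simp add: power2_eq_square) (rule real_less_lsqrt, simp_all add: power2_eq_square)

text \<open>The left side is A minus the threshold times D + C, four moves 2 after the state (a, c,
  d). The forms on the right are eigenforms of the block \<open>2223\<close> for the eigenvalues 3 -
  sqrt 10 and 1. The eigenform for 3 + sqrt 10 is absent precisely because the threshold is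
  \<open>r_one - 1\<close>.\<close>

lemma long_block_form:
  fixes a c d :: real
  shows "5 * a + 3 * c - (17 + sqrt 10) / 31 * (d + 7 * a + 5 * c)
    = (14 * sqrt 10 - 41) / 93 * ((sqrt 10 - 2) / 3 * a - c) - (17 + sqrt 10) / 93 * (3 * d - 2 * a + c)"
proof -
  have "sqrt 10 * sqrt 10 = 10" "sqrt 10 * (sqrt 10 * t) = 10 * t" for t
    by (simp_all flip: mult.assoc)
  then show ?thesis by (simp add: field_simps)
qed

section \<open>The block \<open>2223\<close> as a linear map\<close>

definition block :: "(nat \<Rightarrow> nat) \<Rightarrow> nat \<Rightarrow> bool"
  where "block m i \<longleftrightarrow> m i = 2 \<and> m (i + 1) = 2 \<and> m (i + 2) = 2 \<and> m (i + 3) = 3"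

context
  fixes m :: "nat \<Rightarrow> nat" and A C D :: "nat \<Rightarrow> real"
  assumes orb: "orbit m A C D"
begin

lemma orbit_bounds: "1 \<le> A j" "1 \<le> C j" "0 \<le> D j" "D j \<le> A j"
  using orb unfolding orbit_def by blast+

lemma orbit_moves: "m j = 1 \<or> m j = 2 \<or> m j = 3"
  using orb unfolding orbit_def by auto

lemma move1: "m j = 1 \<Longrightarrow> A (Suc j) = A j" "m j = 1 \<Longrightarrow> C (Suc j) = A j + C j" "m j = 1 \<Longrightarrow> D (Suc j) = D j"
  using orb unfolding orbit_def by blast+

lemma move2: "m j = 2 \<Longrightarrow> A (Suc j) = A j + C j" "m j = 2 \<Longrightarrow> C (Suc j) = A j" "m j = 2 \<Longrightarrow> D (Suc j) = D j + C j"
  using orb unfolding orbit_def by blast+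

lemma move3: "m j = 3 \<Longrightarrow> A (Suc j) = A j + C j" "m j = 3 \<Longrightarrow> C (Suc j) = C j" "m j = 3 \<Longrightarrow> D (Suc j) = D j"
  using orb unfolding orbit_def by blast+

lemma block_states:
  assumes "block m i"
  shows "A (i + 1) = A i + C i" "C (i + 1) = A i" "D (i + 1) = D i + C i"
    "A (i + 2) = 2 * A i + C i" "C (i + 2) = A i + C i" "D (i + 2) = D i + C i + A i"
    "A (i + 3) = 3 * A i + 2 * C i" "C (i + 3) = 2 * A i + C i" "D (i + 3) = D i + 2 * A i + 2 * C i"
    "A (i + 4) = 5 * A i + 3 * C i" "C (i + 4) = 2 * A i + C i" "D (i + 4) = D i + 2 * A i + 2 * C i"
  using assms move2[of i] move2[of "i + 1"] move2[of "i + 2"] move3[of "i + 3"]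
  unfolding block_def by (simp_all add: numeral_eq_Suc)

text \<open>The first two parts iterate the eigenforms of the block. The others are crude growth
  bounds: linear growth is enough from below, and 8 = 5 + 3 bounds the growth of A from above when C
  \<le> A.\<close>

lemma blocks_invariants_all:
  assumes "\<forall>k<n. block m (i + 4 * k)"
  shows "3 * D (i + 4 * n) - 2 * A (i + 4 * n) + C (i + 4 * n) = 3 * D i - 2 * A i + C i
    \<and> (sqrt 10 - 2) / 3 * A (i + 4 * n) - C (i + 4 * n) =
      (3 - sqrt 10) ^ n * ((sqrt 10 - 2) / 3 * A i - C i)
    \<and> (1 + real n) * A i \<le> A (i + 4 * n)
    \<and> (C i \<le> A i \<longrightarrow> C (i + 4 * n) \<le> A (i + 4 * n) \<and> A (i + 4 * n) \<le> 8 ^ n * A i)"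
  using assms
proof (induction n)
  case (Suc n)
  have bl: "block m (i + 4 * n)" and prev: "\<forall>k<n. block m (i + 4 * k)" using Suc.prems by auto
  note IH = Suc.IH[OF prev]
  have st: "A (i + 4 * Suc n) = 5 * A (i + 4 * n) + 3 * C (i + 4 * n)"
    "C (i + 4 * Suc n) = 2 * A (i + 4 * n) + C (i + 4 * n)"
    "D (i + 4 * Suc n) = D (i + 4 * n) + 2 * A (i + 4 * n) + 2 * C (i + 4 * n)"
    using block_states(10-12)[OF bl] by (simp_all add: ac_simps)
  have s: "sqrt 10 * sqrt 10 = 10" "sqrt 10 * (sqrt 10 * t) = 10 * t" for t
    by (simp_all flip: mult.assoc)
  note bd = orbit_bounds[of "i + 4 * n"] orbit_bounds[of i]
  have "3 * D (i + 4 * Suc n) - 2 * A (i + 4 * Suc n) + C (i + 4 * Suc n) = 3 * D i - 2 * A i + C i"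
    using IH[THEN conjunct1] unfolding st by (simp add: algebra_simps)
  moreover have "(sqrt 10 - 2) / 3 * A (i + 4 * Suc n) - C (i + 4 * Suc n)
      = (3 - sqrt 10) * ((sqrt 10 - 2) / 3 * A (i + 4 * n) - C (i + 4 * n))"
    unfolding st using s by (simp add: field_simps)
  then have "(sqrt 10 - 2) / 3 * A (i + 4 * Suc n) - C (i + 4 * Suc n)
      = (3 - sqrt 10) ^ Suc n * ((sqrt 10 - 2) / 3 * A i - C i)"
    using IH by simp
  moreover have "(1 + real (Suc n)) * A i \<le> A (i + 4 * Suc n)"
  proof -
    have "(1 + real (Suc n)) * A i = (1 + real n) * A i + A i" by (simp add: algebra_simps)
    moreover have "0 \<le> real n * A i" using bd by simp
    then have "A i \<le> (1 + real n) * A i" by (simp add: algebra_simps)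
    ultimately show ?thesis using IH[THEN conjunct2, THEN conjunct2, THEN conjunct1] bd unfolding st by linarith
  qed
  moreover have "C i \<le> A i \<longrightarrow> C (i + 4 * Suc n) \<le> A (i + 4 * Suc n) \<and> A (i + 4 * Suc n) \<le> 8 ^ Suc n * A i"
  proof
    assume "C i \<le> A i"
    then have "C (i + 4 * n) \<le> A (i + 4 * n)" "A (i + 4 * n) \<le> 8 ^ n * A i" using IH by blast+
    then show "C (i + 4 * Suc n) \<le> A (i + 4 * Suc n) \<and> A (i + 4 * Suc n) \<le> 8 ^ Suc n * A i"
      using bd unfolding st power_Suc by auto
  qed
  ultimately show ?case by blast
qed simp

lemmas blocks_invariants = blocks_invariants_all[THEN conjunct1]
  blocks_invariants_all[THEN conjunct2, THEN conjunct1]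
  blocks_invariants_all[THEN conjunct2, THEN conjunct2, THEN conjunct1]
  blocks_invariants_all[THEN conjunct2, THEN conjunct2, THEN conjunct2, THEN mp]

lemma long_block_state:
  assumes "m e = 2" "m (e + 1) = 2" "m (e + 2) = 2" "m (e + 3) = 2"
  shows "A (e + 4) = 5 * A e + 3 * C e" "C (e + 4) = 3 * A e + 2 * C e" "D (e + 4) = D e + 4 * A e + 3 * C e"
  using assms move2[of e] move2[of "e + 1"] move2[of "e + 2"] move2[of "e + 3"]
  by (simp_all add: numeral_eq_Suc)

text \<open>The extra move 2 raises 3 D - 2 A + C to 3 d + 3 a + 4 c, and the n blocks in between
  preserve this value. At the next long block it outweighs the contracting eigenform, whatever n
  is.\<close>

lemma two_long_blocks:
  assumes bi: "block m i" and m4: "m (i + 4) = 2"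
    and bl: "\<And>k. k < n \<Longrightarrow> block m (i + 5 + 4 * k)"
    and e: "e = i + 5 + 4 * n" "m e = 2" "m (e + 1) = 2" "m (e + 2) = 2" "m (e + 3) = 2"
  shows "A (e + 4) - (17 + sqrt 10) / 31 * (D (e + 4) + C (e + 4)) \<le> - A i / 3"
proof -
  define a c d where "a = A i" and "c = C i" and "d = D i"
  have pos: "1 \<le> a" "1 \<le> c" "0 \<le> d" using orbit_bounds[of i] by (simp_all add: a_def c_def d_def)
  have w: "A (i + 5) = 7 * a + 4 * c" "C (i + 5) = 5 * a + 3 * c" "D (i + 5) = d + 4 * a + 3 * c"
    using block_states(10-12)[OF bi] move2[of "i + 4"] m4 unfolding a_def c_def d_def
    by (simp_all add: numeral_eq_Suc)
  have "\<forall>k<n. block m (i + 5 + 4 * k)" using bl by blast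
  note inv = blocks_invariants(1,2)[OF this]
  have K: "3 * D e - 2 * A e + C e = 3 * d + 3 * a + 4 * c"
    using inv(1) e(1) w by simp
  define q where "q = (sqrt 10 - 2) / 3 * A (i + 5) - C (i + 5)"
  have z: "0 \<le> (sqrt 10 - 2) / 3" "(sqrt 10 - 2) / 3 \<le> 1 / 2" using sqrt10_bounds by auto
  have "(sqrt 10 - 2) / 3 * A (i + 5) \<le> 1 / 2 * A (i + 5)" "0 \<le> (sqrt 10 - 2) / 3 * A (i + 5)"
    using mult_right_mono[OF z(2), of "A (i + 5)"] mult_nonneg_nonneg[OF z(1), of "A (i + 5)"]
      orbit_bounds(1)[of "i + 5"] by linarith+
  then have q: "\<bar>q\<bar> \<le> 5 * a + 3 * c" using pos w unfolding q_def by linarith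
  have Dz: "(sqrt 10 - 2) / 3 * A e - C e = (3 - sqrt 10) ^ n * q"
    using inv(2) e(1) unfolding q_def by simp
  have "\<bar>3 - sqrt 10\<bar> ^ n \<le> 1" using sqrt10_bounds by (intro power_le_one) auto
  then have "\<bar>(3 - sqrt 10) ^ n * q\<bar> \<le> \<bar>q\<bar>"
    by (simp add: abs_mult power_abs mult_left_le_one_le)
  then have "(3 - sqrt 10) ^ n * q \<le> 5 * a + 3 * c" using q by linarith
  then have "(14 * sqrt 10 - 41) / 93 * ((3 - sqrt 10) ^ n * q) \<le> (14 * sqrt 10 - 41) / 93 * (5 * a + 3 * c)"
    using sqrt10_bounds by (intro mult_left_mono) auto
  also have "\<dots> \<le> 1 / 20 * (5 * a + 3 * c)"
    using sqrt10_bounds pos by (intro mult_right_mono) auto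
  finally have 1: "(14 * sqrt 10 - 41) / 93 * ((sqrt 10 - 2) / 3 * A e - C e) \<le> 1 / 20 * (5 * a + 3 * c)"
    unfolding Dz .
  \<comment> \<open>The factors 1/20 and 1/5 are rational bounds for (14 sqrt 10 - 41) / 93 =
    0.035... and (17 + sqrt 10) / 93 = 0.216...; the difference of the two estimates is at most
    -a/3.\<close>
  have "1 / 5 * (3 * d + 3 * a + 4 * c) \<le> (17 + sqrt 10) / 93 * (3 * D e - 2 * A e + C e)"
    unfolding K using sqrt10_bounds pos by (intro mult_right_mono) auto
  moreover have "A (e + 4) = 5 * A e + 3 * C e" "D (e + 4) + C (e + 4) = D e + 7 * A e + 5 * C e"
    using long_block_state[OF e(2-5)] by simp_all
  ultimately show ?thesis
    using 1 long_block_form[of "A e" "C e" "D e"] pos unfolding a_def[symmetric] by simp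
qed


section \<open>Excluded patterns of moves\<close>

context
  assumes large: "\<And>j. good ((17 + sqrt 10) / 31) (m j) (A j) (C j) (D j)"
begin

text \<open>Since 0.65 lies just below \<open>r_one - 1\<close> = 0.65039..., the patterns below are
  excluded by rational linear arithmetic.\<close>

lemma large_simple: "good (13 / 20) (m j) (A j) (C j) (D j)"
  using large[of j] sqrt10_bounds orbit_bounds[of j] by (intro good_mono[OF large]) auto

lemma large1: "m j = 1 \<Longrightarrow> 13 * (A j + C j) < 20 * A j"
  using large_simple[of j] by (simp add: good_def)

lemma large23:
  assumes "m j \<noteq> 1"
  shows "13 * (A j + C j) < 20 * (D j + C j)" "13 * (D j + C j) < 20 * A j"
  using large_simple[of j] assms by (simp_all add: good_def)

lemma no_11: "m j = 1 \<Longrightarrow> m (Suc j) = 1 \<Longrightarrow> False"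
  using large1[of j] large1[of "Suc j"] move1[of j] orbit_bounds[of j] by simp

lemma no_x1:
  assumes "m j \<noteq> 1" "m (Suc j) = 1" shows False
proof -
  define a c d where "a = A j" and "c = C j" and "d = D j"
  note bd = orbit_bounds[of j, folded a_def c_def d_def]
  note l0 = large23[OF assms(1), folded a_def c_def d_def]
  have "A (Suc j) = a + c" "C (Suc j) = (if m j = 2 then a else c)" "D (Suc j) = (if m j = 2 then d + c else d)"
    using move2[of j] move3[of j] orbit_moves[of j] assms(1) unfolding a_def c_def d_def by auto
  then have l: "A (Suc (Suc j)) = a + c" "C (Suc (Suc j)) = a + c + (if m j = 2 then a else c)"
    "D (Suc (Suc j)) = (if m j = 2 then d + c else d)" "13 * (a + c + (if m j = 2 then a else c)) < 20 * (a + c)"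
    using move1[of "Suc j"] large1[of "Suc j"] assms(2) by simp_all
  have "m (Suc (Suc j)) \<noteq> 1" using no_11[of "Suc j"] assms(2) by auto
  note l2 = large23[OF this, unfolded l]
  show False
  proof (cases "m j = 2")
    case True
    show False using l2 l0 l(4) bd unfolding if_P[OF True] by (simp add: algebra_simps)
  next
    case False
    show False using l2 l0 l(4) bd unfolding if_not_P[OF False] by (simp add: algebra_simps)
  qed
qed

text \<open>The move at index 0 may still be 1; therefore the patterns below begin at
  \<open>Suc j\<close>.\<close>

lemma no_1: "m (Suc j) \<noteq> 1"
  using no_11[of j] no_x1[of j] by blast

lemma moves_23: "m (Suc j) = 2 \<or> m (Suc j) = 3"
  using no_1[of j] orbit_moves[of "Suc j"] by blast

lemma no_233:
  assumes "m (Suc j) = 2" "m (j + 2) = 3" "m (j + 3) = 3" shows False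
  using large23[of "j + 1"] large23[of "j + 2"] large23[of "j + 3"] large23[of "j + 4"]
    no_1[of "j + 3"] move2[of "j + 1"] move3[of "j + 2"] move3[of "j + 3"]
    orbit_bounds[of "j + 1"] assms
  by (simp add: numeral_eq_Suc algebra_simps)

lemma no_323:
  assumes "m (Suc j) = 3" "m (j + 2) = 2" "m (j + 3) = 3" shows False
  using large23[of "j + 1"] large23[of "j + 2"] large23[of "j + 3"] large23[of "j + 4"]
    no_1[of "j + 3"] move3[of "j + 1"] move2[of "j + 2"] move3[of "j + 3"]
    orbit_bounds[of "j + 1"] assms
  by (simp add: numeral_eq_Suc algebra_simps)

lemma no_23223:
  assumes "m (Suc j) = 2" "m (j + 2) = 3" "m (j + 3) = 2" "m (j + 4) = 2" "m (j + 5) = 3" shows False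
proof -
  define a c d where "a = A (Suc j)" and "c = C (Suc j)" and "d = D (Suc j)"
  have s1: "A (Suc j) = a" "C (Suc j) = c" "D (Suc j) = d" by (simp_all add: a_def c_def d_def)
  have s2: "A (j + 2) = a + c" "C (j + 2) = a" "D (j + 2) = d + c"
    using move2[OF assms(1)] s1 by (simp_all add: numeral_eq_Suc)
  have s3: "A (j + 3) = 2 * a + c" "C (j + 3) = a" "D (j + 3) = d + c"
    using move3[OF assms(2)] s2 by (simp_all add: numeral_eq_Suc)
  have s4: "A (j + 4) = 3 * a + c" "C (j + 4) = 2 * a + c" "D (j + 4) = d + c + a"
    using move2[OF assms(3)] s3 by (simp_all add: numeral_eq_Suc)
  have s5: "A (j + 5) = 5 * a + 2 * c" "C (j + 5) = 3 * a + c" "D (j + 5) = d + 3 * a + 2 * c"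
    using move2[OF assms(4)] s4 by (simp_all add: numeral_eq_Suc)
  have s6: "A (j + 6) = 8 * a + 3 * c" "C (j + 6) = 3 * a + c" "D (j + 6) = d + 3 * a + 2 * c"
    using move3[OF assms(5)] s5 by (simp_all add: numeral_eq_Suc)
  have "m (j + 6) \<noteq> 1" using no_1[of "j + 5"] by (simp add: numeral_eq_Suc)
  note large23[OF this, unfolded s6]
  moreover have "m (Suc j) \<noteq> 1" using assms(1) by simp
  note large23[OF this, unfolded s1]
  moreover have "m (j + 2) \<noteq> 1" using assms(2) by simp
  note large23[OF this, unfolded s2]
  moreover have "m (j + 3) \<noteq> 1" using assms(3) by simp
  note large23[OF this, unfolded s3]
  moreover have "m (j + 4) \<noteq> 1" using assms(4) by simp
  note large23[OF this, unfolded s4]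
  moreover have "m (j + 5) \<noteq> 1" using assms(5) by simp
  note large23[OF this, unfolded s5]
  ultimately show False using orbit_bounds[of "Suc j", unfolded s1] by (simp add: algebra_simps)
qed

lemma no_22222:
  assumes "m (Suc j) = 2" "m (j + 2) = 2" "m (j + 3) = 2" "m (j + 4) = 2" "m (j + 5) = 2" shows False
proof -
  define a c d where "a = A (Suc j)" and "c = C (Suc j)" and "d = D (Suc j)"
  have s1: "A (Suc j) = a" "C (Suc j) = c" "D (Suc j) = d" by (simp_all add: a_def c_def d_def)
  have s2: "A (j + 2) = a + c" "C (j + 2) = a" "D (j + 2) = d + c"
    using move2[OF assms(1)] s1 by (simp_all add: numeral_eq_Suc)
  have s3: "A (j + 3) = 2 * a + c" "C (j + 3) = a + c" "D (j + 3) = d + c + a"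
    using move2[OF assms(2)] s2 by (simp_all add: numeral_eq_Suc)
  have s4: "A (j + 4) = 3 * a + 2 * c" "C (j + 4) = 2 * a + c" "D (j + 4) = d + 2 * a + 2 * c"
    using move2[OF assms(3)] s3 by (simp_all add: numeral_eq_Suc)
  have s5: "A (j + 5) = 5 * a + 3 * c" "C (j + 5) = 3 * a + 2 * c" "D (j + 5) = d + 4 * a + 3 * c"
    using move2[OF assms(4)] s4 by (simp_all add: numeral_eq_Suc)
  have s6: "A (j + 6) = 8 * a + 5 * c" "C (j + 6) = 5 * a + 3 * c" "D (j + 6) = d + 7 * a + 5 * c"
    using move2[OF assms(5)] s5 by (simp_all add: numeral_eq_Suc)
  have "m (j + 6) \<noteq> 1" using no_1[of "j + 5"] by (simp add: numeral_eq_Suc)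
  note large23[OF this, unfolded s6]
  moreover have "m (Suc j) \<noteq> 1" using assms(1) by simp
  note large23[OF this, unfolded s1]
  moreover have "m (j + 2) \<noteq> 1" using assms(2) by simp
  note large23[OF this, unfolded s2]
  moreover have "m (j + 3) \<noteq> 1" using assms(3) by simp
  note large23[OF this, unfolded s3]
  moreover have "m (j + 4) \<noteq> 1" using assms(4) by simp
  note large23[OF this, unfolded s4]
  moreover have "m (j + 5) \<noteq> 1" using assms(5) by simp
  note large23[OF this, unfolded s5]
  ultimately show False using orbit_bounds[of "Suc j", unfolded s1] by (simp add: algebra_simps)
qed

text \<open>Under moves 3 alone A grows without bound while C and D stay fixed, so D + C becomes too
  small relative to A + C.\<close>

lemma ex_2: "\<exists>j. m (Suc j) = 2"
proof (rule ccontr)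
  assume "\<not> ?thesis"
  then have 3: "m (Suc j) = 3" for j using moves_23 by blast
  have st: "A (Suc j) = A 1 + real j * C 1 \<and> C (Suc j) = C 1 \<and> D (Suc j) = D 1" for j
    using move3[OF 3] by (induction j) (simp_all add: algebra_simps)
  obtain j :: nat where j: "20 * (D 1 + C 1) < real j" using reals_Archimedean2 by blast
  have "real j \<le> real j * C 1" using orbit_bounds[of 1] by (simp add: mult_le_cancel_left1)
  then show False using large23(1)[of "Suc j"] st[of j] 3 j orbit_bounds[of 1] by simp
qed

text \<open>Since \<open>233\<close> is excluded, a pair \<open>33\<close> is preceded by another 3,
  and so on back to the known move 2.\<close>

lemma no_33_later: "m (Suc i) = 2 \<Longrightarrow> i \<le> j \<Longrightarrow> m (Suc j) = 3 \<Longrightarrow> m (Suc (Suc j)) = 3 \<Longrightarrow> False"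
proof (induction j)
  case (Suc j)
  then have "i \<le> j" by (cases "i = Suc j") auto
  then have "m (Suc j) \<noteq> 3" using Suc by blast
  then have "m (Suc j) = 2" using moves_23[of j] by blast
  then show ?case using no_233[of j] Suc.prems by (simp add: numeral_eq_Suc)
qed simp

text \<open>Excluding \<open>33\<close>, \<open>323\<close> and \<open>23223\<close> forces at least
  three moves 2 after a 3; excluding \<open>22222\<close> allows at most four.\<close>

lemma after_3:
  assumes i: "m (Suc i) = 2" "i < s" "m (Suc s) = 3"
  shows "block m (s + 2) \<or> m (s + 2) = 2 \<and> block m (s + 3)"
proof -
  have prev: "m s = 2"
  proof (cases s)
    case (Suc r)
    then show ?thesis using no_33_later[OF i(1), of r] i moves_23[of r] by auto
  qed (use i in simp)
  have m23: "m (s + k) = 2 \<or> m (s + k) = 3" if "k > 0" for k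
    using moves_23[of "s + (k - 1)"] that by simp
  have 2: "m (s + 2) = 2" using no_33_later[OF i(1), of s] i m23[of 2] by (auto simp: numeral_eq_Suc)
  have 3: "m (s + 3) = 2" using no_323[of s] i 2 m23[of 3] by (auto simp: numeral_eq_Suc)
  obtain r where r: "s = Suc r" using i by (cases s) auto
  have 4: "m (s + 4) = 2" using no_23223[of r] i 2 3 prev m23[of 4] unfolding r by (auto simp: numeral_eq_Suc)
  have "m (s + 6) = 3" if "m (s + 5) = 2"
    using no_22222[of "s + 1"] 2 3 4 that m23[of 6] by (auto simp: numeral_eq_Suc)
  then show ?thesis using 2 3 4 m23[of 5] unfolding block_def by (auto simp: numeral_eq_Suc)
qed

lemma ex_3_after:
  shows "\<exists>s\<ge>i. m (Suc s) = 3"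
proof (rule ccontr)
  assume "\<not> ?thesis"
  then have "m (Suc s) = 2" if "s \<ge> i" for s using moves_23[of s] that by blast
  then have "m (Suc i) = 2" "m (i + 2) = 2" "m (i + 3) = 2" "m (i + 4) = 2" "m (i + 5) = 2"
    by (simp_all add: numeral_eq_Suc)
  then show False by (rule no_22222)
qed

lemma eventually_blocks: "\<exists>i. \<forall>k. block m (i + 4 * k)"
proof -
  obtain i0 where i0: "m (Suc i0) = 2" using ex_2 by blast
  have next_block: "block m (i + 4) \<or> m (i + 4) = 2 \<and> block m (i + 5)" if "block m i" "i > i0" for i
    using after_3[OF i0, of "i + 2"] that unfolding block_def by (simp add: numeral_eq_Suc)
  obtain s where s: "s \<ge> Suc i0" "m (Suc s) = 3" using ex_3_after by blast
  then obtain i where i: "i > i0" "block m i" using after_3[OF i0 _ s(2)]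
    by (meson add_leD1 le_imp_less_Suc less_le_trans Suc_le_lessD trans_less_add1)
  show ?thesis
  proof (cases "\<forall>k. block m (i + 4 * k)")
    case False
    define n where "n = (LEAST k. \<not> block m (i + 4 * k))"
    have n: "\<not> block m (i + 4 * n)" using False LeastI_ex[of "\<lambda>k. \<not> block m (i + 4 * k)"] unfolding n_def by blast
    have less: "block m (i + 4 * k)" if "k < n" for k using not_less_Least that unfolding n_def by blast
    have "n \<noteq> 0" using n i by (cases n) auto
    then obtain l where l: "n = Suc l" by (cases n) auto
    \<comment> \<open>The last short block before the first failure. Together with the long block
      after it, it meets the hypotheses of \<open>two_long_blocks\<close>, which then rules out any
      further long block.\<close>
    define e where "e = i + 4 * l"
    have e: "block m e" "\<not> block m (e + 4)" "e > i0" using less[of l] n i unfolding e_def l by (simp_all add: ac_simps)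
    then have e4: "m (e + 4) = 2" "block m (e + 5)" using next_block by blast+
    have "block m (e + 5 + 4 * k)" for k
    proof (induction k rule: less_induct)
      case (less k)
      show ?case
      proof (cases k)
        case (Suc l)
        define f where "f = e + 5 + 4 * l"
        have "block m f" using less[of l] Suc unfolding f_def by simp
        moreover have "False" if "m (f + 4) = 2" "block m (f + 5)"
        proof -
          have "A (f + 4 + 4) - (17 + sqrt 10) / 31 * (D (f + 4 + 4) + C (f + 4 + 4)) \<le> - A e / 3"
          proof (rule two_long_blocks[OF e(1) e4(1), of k])
            show "block m (e + 5 + 4 * j)" if "j < k" for j using less that by blast
            show "f + 4 = e + 5 + 4 * k" unfolding f_def Suc by simp
            show "m (f + 4) = 2" "m (f + 4 + 1) = 2" "m (f + 4 + 2) = 2" "m (f + 4 + 3) = 2"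
              using that unfolding block_def by (simp_all add: numeral_eq_Suc)
          qed
          moreover have "m (f + 4 + 4) \<noteq> 1" using that unfolding block_def by (simp add: numeral_eq_Suc)
          then have "(17 + sqrt 10) / 31 * (D (f + 4 + 4) + C (f + 4 + 4)) < A (f + 4 + 4)"
            using large[of "f + 4 + 4"] by (simp add: good_def)
          ultimately show False using orbit_bounds(1)[of e] by simp
        qed
        ultimately have "block m (f + 4)" using next_block[of f] e(3) unfolding f_def by auto
        then show ?thesis unfolding f_def Suc by (simp add: ac_simps)
      qed (use e4 in simp)
    qed
    then show ?thesis by blast
  qed blast
qed

end

end

text \<open>The inequalities of \<open>good\<close> at the four moves of a block that starts in the
  state (a, c, d), in pairs. The last one, at the move 3, is critical and has a threshold of its
  own.\<close>

definition block_conds :: "real \<Rightarrow> real \<Rightarrow> real \<Rightarrow> real \<Rightarrow> real \<Rightarrow> bool"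
  where "block_conds q t a c d \<longleftrightarrow> q * (a + c) < d + c \<and> q * (d + c) < a \<and>
    q * (2 * a + c) < d + c + a \<and> q * (d + c + a) < a + c \<and>
    q * (3 * a + 2 * c) < d + 2 * a + 2 * c \<and> q * (d + 2 * a + 2 * c) < 2 * a + c \<and>
    q * (5 * a + 3 * c) < d + 4 * a + 3 * c \<and> t * (d + 4 * a + 3 * c) < 3 * a + 2 * c"

lemma block_good:
  assumes orb: "orbit m A C D" and bl: "block m i" and bc: "block_conds q t (A i) (C i) (D i)"
    and t: "t \<le> q" and l: "l < 4"
  shows "good t (m (i + l)) (A (i + l)) (C (i + l)) (D (i + l))"
proof -
  note st = block_states[OF orb bl]
  have t1: "t * s \<le> q * s" if "0 \<le> s" for s using t that by (rule mult_right_mono)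
  have pos: "0 \<le> A i" "0 \<le> C i" "0 \<le> D i" using orbit_bounds[OF orb, of i] by auto
  consider "l = 0" | "l = 1" | "l = 2" | "l = 3" using l by linarith
  then show ?thesis
  proof cases
    case 1
    then show ?thesis
      using bl bc t1[of "A i + C i"] t1[of "D i + C i"] pos
      by (simp add: good_def block_def block_conds_def)
  next
    case 2
    then show ?thesis
      using bl bc st(1-3) t1[of "2 * A i + C i"] t1[of "D i + C i + A i"] pos
      by (simp add: good_def block_def block_conds_def algebra_simps)
  next
    case 3
    then show ?thesis
      using bl bc st(4-6) t1[of "3 * A i + 2 * C i"] t1[of "D i + 2 * A i + 2 * C i"] pos
      by (simp add: good_def block_def block_conds_def algebra_simps)
  next
    case 4
    then show ?thesis
      using bl bc st(7-9) t1[of "5 * A i + 3 * C i"] pos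
      by (simp add: good_def block_def block_conds_def algebra_simps)
  qed
qed

section \<open>The limit direction of repeated blocks\<close>

lemma blocks_linear_form:
  assumes orb: "orbit m A C D" and bl: "\<forall>k. block m (i + 4 * k)"
    and pos: "0 < \<alpha> + \<beta> * ((sqrt 10 - 2) / 3) + \<gamma> * ((8 - sqrt 10) / 9)"
  shows "\<forall>\<^sub>F k in sequentially. 0 < \<alpha> * A (i + 4 * k) + \<beta> * C (i + 4 * k) + \<gamma> * D (i + 4 * k)"
proof -
  define z where "z = (sqrt 10 - 2) / 3"
  define e where "e = z * A i - C i"
  define K where "K = 3 * D i - 2 * A i + C i"
  \<comment> \<open>The value of the form in the limit direction (1, z, (2 - z) / 3). On the orbit
    the form equals \<delta> a up to the bounded eigenforms, which \<open>M\<close> controls, and a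
    is unbounded.\<close>
  define \<delta> where "\<delta> = \<alpha> + \<beta> * z + \<gamma> * ((2 - z) / 3)"
  define M where "M = \<bar>\<beta>\<bar> * \<bar>e\<bar> + \<bar>\<gamma>\<bar> * ((\<bar>K\<bar> + \<bar>e\<bar>) / 3)"
  have \<delta>: "0 < \<delta>" using pos unfolding \<delta>_def z_def by (simp add: field_simps)
  obtain N :: nat where N: "M / \<delta> < real N" using reals_Archimedean2 by blast
  have "0 < \<alpha> * A (i + 4 * k) + \<beta> * C (i + 4 * k) + \<gamma> * D (i + 4 * k)" if "k \<ge> N" for k
  proof -
    have blk: "\<forall>j<k. block m (i + 4 * j)" using bl by blast
    define a where "a = A (i + 4 * k)"
    define f where "f = (3 - sqrt 10) ^ k * e"
    have C: "C (i + 4 * k) = z * a - f"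
      using blocks_invariants(2)[OF orb blk] unfolding a_def f_def e_def z_def by linarith
    have D: "D (i + 4 * k) = (K + (2 - z) * a + f) / 3"
      using blocks_invariants(1)[OF orb blk] C unfolding a_def[symmetric] K_def[symmetric] by (simp add: algebra_simps)
    have "\<bar>3 - sqrt 10\<bar> ^ k \<le> 1" using sqrt10_bounds by (intro power_le_one) auto
    then have f: "\<bar>f\<bar> \<le> \<bar>e\<bar>" unfolding f_def by (simp add: abs_mult power_abs mult_left_le_one_le)
    have "real N * 1 \<le> (1 + real k) * A i"
      using that orbit_bounds(1)[OF orb, of i] by (intro mult_mono) auto
    then have "real N \<le> a" using blocks_invariants(3)[OF orb blk] unfolding a_def by linarith
    then have "M / \<delta> < a" using N by linarith
    then have "M < \<delta> * a" using \<delta> by (simp add: field_simps)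
    moreover have "\<bar>\<beta> * f\<bar> \<le> \<bar>\<beta>\<bar> * \<bar>e\<bar>" using f by (simp add: abs_mult mult_left_mono)
    moreover have "\<bar>\<gamma> * ((K + f) / 3)\<bar> \<le> \<bar>\<gamma>\<bar> * ((\<bar>K\<bar> + \<bar>e\<bar>) / 3)"
      unfolding abs_mult using f by (intro mult_left_mono) auto
    moreover have "\<alpha> * a + \<beta> * C (i + 4 * k) + \<gamma> * D (i + 4 * k) = \<delta> * a - \<beta> * f + \<gamma> * ((K + f) / 3)"
      unfolding C D \<delta>_def by (simp add: field_simps)
    ultimately show ?thesis unfolding M_def a_def by linarith
  qed
  then show ?thesis unfolding eventually_sequentially by blast
qed

lemma blocks_good:
  assumes orb: "orbit m A C D" and bl: "\<forall>k. block m (i + 4 * k)" and t: "t < sqrt 10 - 5 / 2"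
  shows "\<exists>J. \<forall>j\<ge>J. m j \<noteq> 1 \<and> good t (m j) (A j) (C j) (D j)"
proof -
  \<comment> \<open>0.6624 is slightly above sqrt 10 - 5/2 = 0.66227...; seven of the eight
    conditions hold in the limit even for q, and only the critical one needs the sharp
    bound.\<close>
  define q :: real where "q = 6624 / 10000"
  note lf = blocks_linear_form[OF orb bl]
  note b = sqrt10_bounds
  have s: "sqrt 10 * sqrt 10 = 10" by simp
  \<comment> \<open>In the limit direction, with A = 1 at the start of the block, D + C and A at its
    move 3 are (26 + 8 sqrt 10) / 9 and (5 + 2 sqrt 10) / 3.\<close>
  have "t * ((26 + 8 * sqrt 10) / 9) < (sqrt 10 - 5 / 2) * ((26 + 8 * sqrt 10) / 9)"
    using t b by (intro mult_strict_right_mono) auto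
  also have "\<dots> = (5 + 2 * sqrt 10) / 3" using s by (simp add: field_simps)
  finally have 8: "0 < (3 - 4 * t) + (2 - 3 * t) * ((sqrt 10 - 2) / 3) + (- t) * ((8 - sqrt 10) / 9)"
    by (simp add: field_simps)
  have 1: "0 < (- q) + (1 - q) * ((sqrt 10 - 2) / 3) + (1) * ((8 - sqrt 10) / 9)"
    using b by (simp add: q_def field_simps)
  have 2: "0 < (1) + (- q) * ((sqrt 10 - 2) / 3) + (- q) * ((8 - sqrt 10) / 9)"
    using b by (simp add: q_def field_simps)
  have 3: "0 < (1 - 2 * q) + (1 - q) * ((sqrt 10 - 2) / 3) + (1) * ((8 - sqrt 10) / 9)"
    using b by (simp add: q_def field_simps)
  have 4: "0 < (1 - q) + (1 - q) * ((sqrt 10 - 2) / 3) + (- q) * ((8 - sqrt 10) / 9)"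
    using b by (simp add: q_def field_simps)
  have 5: "0 < (2 - 3 * q) + (2 - 2 * q) * ((sqrt 10 - 2) / 3) + (1) * ((8 - sqrt 10) / 9)"
    using b by (simp add: q_def field_simps)
  have 6: "0 < (2 - 2 * q) + (1 - 2 * q) * ((sqrt 10 - 2) / 3) + (- q) * ((8 - sqrt 10) / 9)"
    using b by (simp add: q_def field_simps)
  have 7: "0 < (4 - 5 * q) + (3 - 3 * q) * ((sqrt 10 - 2) / 3) + (1) * ((8 - sqrt 10) / 9)"
    using b by (simp add: q_def field_simps)
  have "\<forall>\<^sub>F k in sequentially. block_conds q t (A (i + 4 * k)) (C (i + 4 * k)) (D (i + 4 * k))"
    using lf[OF 1] lf[OF 2] lf[OF 3] lf[OF 4] lf[OF 5] lf[OF 6] lf[OF 7] lf[OF 8]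
    by eventually_elim (simp add: block_conds_def algebra_simps)
  then obtain N where N: "\<And>k. k \<ge> N \<Longrightarrow> block_conds q t (A (i + 4 * k)) (C (i + 4 * k)) (D (i + 4 * k))"
    unfolding eventually_sequentially by blast
  have "m j \<noteq> 1 \<and> good t (m j) (A j) (C j) (D j)" if j: "j \<ge> i + 4 * N" for j
  proof -
    define k l where "k = (j - i) div 4" and "l = (j - i) mod 4"
    have kl: "j = i + 4 * k + l" "k \<ge> N" "l < 4" using j unfolding k_def l_def by auto
    have "l = 0 \<or> l = 1 \<or> l = 2 \<or> l = 3" using kl(3) by linarith
    then have "m j \<noteq> 1" using bl[rule_format, of k] unfolding kl(1) block_def by (auto simp: add.assoc)
    moreover have "t \<le> q" using t b by (simp add: q_def)
    then have "good t (m j) (A j) (C j) (D j)"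
      unfolding kl(1) by (intro block_good[OF orb bl[rule_format] N[OF kl(2)] _ kl(3)])
    ultimately show ?thesis by blast
  qed
  then show ?thesis by blast
qed

lemma Sturmian_gap:
  assumes x: "x \<in> Sturmian" and gt: "ereal r_one < rep x"
  shows "ereal r_max \<le> rep x"
proof -
  define \<rho> where "\<rho> = (17 + sqrt 10) / 31"
  have r1: "r_one = 1 + \<rho>" by (simp add: r_one_def \<rho>_def field_simps)
  have \<rho>: "0 < \<rho>" using sqrt10_bounds by (simp add: \<rho>_def)
  obtain F m where dir: "directed x F m" using Sturmian_directed[OF x] by blast
  define A C D where "A j = size_u (F j)" and "C j = size_v (F j)" and "D j = size_w (F j)" for j
  have orb: "orbit m A C D" using directed_orbit[OF dir] unfolding A_def C_def D_def .
  obtain J where J: "\<And>j. j \<ge> J \<Longrightarrow> good \<rho> (m j) (A j) (C j) (D j)"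
    using directed_good[OF dir \<rho>] gt unfolding r1 A_def C_def D_def by blast
  have "\<exists>i. \<forall>k. block (\<lambda>j. m (J + j)) (i + 4 * k)"
    using J unfolding \<rho>_def by (intro eventually_blocks[OF orbit_shift[OF orb]]) auto
  then obtain i where "\<forall>k. block m ((J + i) + 4 * k)" by (auto simp: block_def add.assoc)
  note good = blocks_good[OF orb this]
  show ?thesis
  proof (rule ccontr)
    assume "\<not> ?thesis"
    then have "rep x < ereal r_max" by simp
    from ereal_dense2[OF this] obtain z where z: "rep x < ereal z" "ereal z < ereal r_max" by blast
    have "ereal r_one < ereal z" using gt z(1) by (rule less_trans)
    then have "0 \<le> z - 1" using \<rho> r1 by simp
    moreover have "z - 1 \<le> 1" "z - 1 < sqrt 10 - 5 / 2" using z(2) sqrt10_bounds by (simp_all add: r_max_def)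
    moreover obtain N where "\<And>j. j \<ge> N \<Longrightarrow> m j \<noteq> 1 \<and> good (z - 1) (m j) (A j) (C j) (D j)"
      using good calculation(3) by blast
    ultimately have "ereal (1 + (z - 1)) \<le> rep x"
      by (intro directed_rep_ge[OF dir x, of _ N]) (simp_all add: A_def C_def D_def)
    then show False using z(1) by simp
  qed
qed

section \<open>Sturmian words with exponent slightly below the gap\<close>

definition period_moves :: "nat \<Rightarrow> nat \<Rightarrow> nat"
  where "period_moves k j =
    (if j mod (4 * k + 1) \<noteq> 0 \<and> j mod (4 * k + 1) mod 4 = 0 then 3 else 2)"

lemma period_moves_start: "period_moves k (p * (4 * k + 1)) = 2"
proof -
  have "p * (4 * k + 1) mod (4 * k + 1) = 0" by (rule mod_mult_self2_is_0)
  then show ?thesis unfolding period_moves_def by (simp only:) simp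
qed

lemma period_moves_block:
  assumes "b < k" shows "block (period_moves k) (p * (4 * k + 1) + 1 + 4 * b)"
proof -
  have "(p * n + r) mod n = r" if "r < n" for n r :: nat using that by simp
  from this[of _ "4 * k + 1"]
  have "period_moves k (p * (4 * k + 1) + r) = (if r \<noteq> 0 \<and> r mod 4 = 0 then 3 else 2)"
    if "r < 4 * k + 1" for r using that by (simp add: period_moves_def)
  note st = this
  have "(4 * b + 2) mod 4 = 2" "(4 * b + 3) mod 4 = 3" by presburger+
  then have "period_moves k (p * (4 * k + 1) + (4 * b + 1)) = 2" "period_moves k (p * (4 * k + 1) + (4 * b + 2)) = 2"
    "period_moves k (p * (4 * k + 1) + (4 * b + 3)) = 2" "period_moves k (p * (4 * k + 1) + (4 * b + 4)) = 3"
    using assms by (subst st; simp)+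
  then show ?thesis unfolding block_def by (simp add: ac_simps numeral_eq_Suc)
qed

lemma period_moves_cases:
  fixes j k :: nat
  obtains p where "j = p * (4 * k + 1)" | p b l where "b < k" "l < 4" "j = p * (4 * k + 1) + 1 + 4 * b + l"
proof (cases "j mod (4 * k + 1) = 0")
  case True
  then show thesis using that(1)[of "j div (4 * k + 1)"] by (metis add.right_neutral div_mult_mod_eq)
next
  case False
  define r where "r = j mod (4 * k + 1)"
  have r: "0 < r" "r < 4 * k + 1" using False unfolding r_def by auto
  have "(r - 1) div 4 < k" "(r - 1) mod 4 < 4" using r by (simp_all add: less_mult_imp_div_less mult.commute)
  moreover have "j = j div (4 * k + 1) * (4 * k + 1) + 1 + 4 * ((r - 1) div 4) + (r - 1) mod 4"
    using r div_mult_mod_eq[of j "4 * k + 1"] unfolding r_def[symmetric] by (simp add: add.assoc)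
  ultimately show thesis using that(2) by blast
qed

lemma period_moves_next: "period_moves k j = 3 \<Longrightarrow> period_moves k (Suc j) = 2"
  by (auto simp: period_moves_def mod_Suc split: if_splits)

text \<open>A rational box around the limit ratios c / a = 0.3874... and d / a = 0.5375..., which
  any state enters within three blocks.\<close>

definition narrow :: "real \<Rightarrow> real \<Rightarrow> real \<Rightarrow> bool"
  where "narrow a c d \<longleftrightarrow> 387 * a \<le> 1000 * c \<and> 1000 * c \<le> 388 * a \<and> 530 * a \<le> 1000 * d \<and> 1000 * d \<le> 545 * a"

lemma narrow_after_blocks:
  assumes orb: "orbit m A C D" and bl: "block m i" "block m (i + 4)" "block m (i + 8)"
  shows "narrow (A (i + 12)) (C (i + 12)) (D (i + 12))"
  using block_states(10-12)[OF orb bl(1)] block_states(10-12)[OF orb bl(2)] block_states(10-12)[OF orb bl(3)]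
    orbit_bounds[OF orb, of i]
  by (simp add: narrow_def add.assoc)

text \<open>q = 0.6504 is just above \<open>r_one - 1\<close>. The parts treat a block that starts
  in the box, the extra move 2, and the three blocks after it. In the first of these three the
  critical condition fails for q in the limit direction, hence the separate threshold t and the
  hypothesis.\<close>

lemma narrow_conds:
  fixes a c d t :: real
  assumes nar: "narrow a c d" and a: "0 < a"
  defines "q \<equiv> 813 / 1250"
  shows "block_conds q q a c d"
    and "q * (a + c) < d + c" "q * (d + c) < a"
    and "t * (d + 7 * a + 5 * c) < 5 * a + 3 * c \<Longrightarrow> block_conds q t (a + c) a (d + c)"
    and "block_conds q q (8 * a + 5 * c) (3 * a + 2 * c) (d + 4 * a + 3 * c)"
    and "block_conds q q (49 * a + 31 * c) (19 * a + 12 * c) (d + 26 * a + 17 * c)"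
  using nar a unfolding narrow_def block_conds_def q_def by (auto simp: field_simps)

lemma orbit_C_le_A: "orbit m A C D \<Longrightarrow> m j \<noteq> 1 \<Longrightarrow> C (Suc j) \<le> A (Suc j)"
  using orbit_moves[of m A C D j] move2[of m A C D j] move3[of m A C D j] orbit_bounds[of m A C D j] by auto

section \<open>Estimates along one period\<close>

context
  fixes k :: nat and A C D :: "nat \<Rightarrow> real"
  assumes orb: "orbit (period_moves k) A C D" and k: "3 \<le> k"
begin

abbreviation start :: "nat \<Rightarrow> nat" where "start p \<equiv> p * (4 * k + 1)"

lemma blocks_before_start:
  assumes "l < k"
  shows "block (period_moves k) (start p + 1 + 4 * l)"
  using period_moves_block[OF assms] .

lemma start_Suc: "start p + 1 + 4 * k = start (Suc p)"
  by simp

lemma C_le_A: "C (Suc j) \<le> A (Suc j)"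
  by (rule orbit_C_le_A[OF orb]) (simp add: period_moves_def)

lemma narrow_late:
  assumes "3 \<le> l" "l \<le> k"
  shows "narrow (A (start p + 1 + 4 * l)) (C (start p + 1 + 4 * l)) (D (start p + 1 + 4 * l))"
proof -
  obtain r where r: "l = r + 3" using assms(1) by (metis add.commute le_Suc_ex)
  have "block (period_moves k) (start p + 1 + 4 * r)" "block (period_moves k) (start p + 1 + 4 * (r + 1))"
    "block (period_moves k) (start p + 1 + 4 * (r + 2))"
    using assms(2) r by (simp_all only: blocks_before_start)
  from narrow_after_blocks[OF orb, of "start p + 1 + 4 * r"] this show ?thesis
    unfolding r by (simp add: ac_simps)
qed

lemma narrow_start: "narrow (A (start (Suc p))) (C (start (Suc p))) (D (start (Suc p)))"
  using narrow_late[OF k order.refl, of p] unfolding start_Suc .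

text \<open>With w the start of the k blocks before e, \<open>long_block_form\<close> shows that the
  threshold (17 + sqrt 10) / 31 is missed by at most (1/20 + 1/2) A w. Lowering it by \<epsilon>
  gains at least \<epsilon> A e \<ge> \<epsilon> (1 + k) A w \<ge> A w.\<close>

lemma critical_condition:
  fixes p :: nat
  assumes \<epsilon>: "0 \<le> \<epsilon>" "1 \<le> \<epsilon> * (1 + real k)"
  defines "t \<equiv> (17 + sqrt 10) / 31 - \<epsilon>" and "e \<equiv> start (Suc p)"
  shows "t * (D e + 7 * A e + 5 * C e) < 5 * A e + 3 * C e"
proof -
  define w where "w = start p + 1"
  have e: "e = w + 4 * k" unfolding e_def w_def using start_Suc by simp
  have "\<forall>l<k. block (period_moves k) (w + 4 * l)" unfolding w_def using blocks_before_start by blast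
  note inv = blocks_invariants(1-3)[OF orb this, folded e]
  have Cw: "C w \<le> A w" unfolding w_def using C_le_A by simp
  note bw = orbit_bounds[OF orb, of w] and be = orbit_bounds[OF orb, of e]
  define q where "q = (sqrt 10 - 2) / 3 * A w - C w"
  have "(sqrt 10 - 2) / 3 * A w \<le> 1 / 2 * A w" "0 \<le> (sqrt 10 - 2) / 3 * A w"
    using sqrt10_bounds bw by (intro mult_right_mono mult_nonneg_nonneg; simp)+
  then have q: "\<bar>q\<bar> \<le> A w" using Cw bw unfolding q_def by linarith
  have "\<bar>3 - sqrt 10\<bar> ^ k \<le> 1" using sqrt10_bounds by (intro power_le_one) auto
  then have "\<bar>(3 - sqrt 10) ^ k * q\<bar> \<le> \<bar>q\<bar>"
    by (simp add: abs_mult power_abs mult_left_le_one_le)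
  then have "- A w \<le> (3 - sqrt 10) ^ k * q" using q by linarith
  then have "(14 * sqrt 10 - 41) / 93 * (- A w) \<le> (14 * sqrt 10 - 41) / 93 * ((3 - sqrt 10) ^ k * q)"
    using sqrt10_bounds by (intro mult_left_mono) auto
  moreover have "(14 * sqrt 10 - 41) / 93 * A w \<le> 1 / 20 * A w"
    using sqrt10_bounds bw by (intro mult_right_mono) auto
  ultimately have 1: "- (1 / 20 * A w) \<le> (14 * sqrt 10 - 41) / 93 * ((3 - sqrt 10) ^ k * q)" by simp
  have "(17 + sqrt 10) / 93 * (3 * D w - 2 * A w + C w) \<le> (17 + sqrt 10) / 93 * (2 * A w)"
    using sqrt10_bounds bw Cw by (intro mult_left_mono) auto
  also have "\<dots> \<le> 1 / 4 * (2 * A w)" using sqrt10_bounds bw by (intro mult_right_mono) auto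
  finally have 2: "(17 + sqrt 10) / 93 * (3 * D w - 2 * A w + C w) \<le> 1 / 2 * A w" by simp
  have "1 * A w \<le> (\<epsilon> * (1 + real k)) * A w" using \<epsilon> bw by (intro mult_right_mono) auto
  also have "\<dots> = \<epsilon> * ((1 + real k) * A w)" by simp
  also have "\<dots> \<le> \<epsilon> * A e" using inv(3) \<epsilon> by (intro mult_left_mono) auto
  also have "\<dots> \<le> \<epsilon> * (D e + 7 * A e + 5 * C e)" using be \<epsilon> by (intro mult_left_mono) auto
  finally have 3: "A w \<le> \<epsilon> * (D e + 7 * A e + 5 * C e)" by simp
  have "5 * A e + 3 * C e - t * (D e + 7 * A e + 5 * C e)
      = (5 * A e + 3 * C e - (17 + sqrt 10) / 31 * (D e + 7 * A e + 5 * C e)) + \<epsilon> * (D e + 7 * A e + 5 * C e)"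
    unfolding t_def by (simp add: algebra_simps)
  also have "\<dots> = (14 * sqrt 10 - 41) / 93 * ((3 - sqrt 10) ^ k * q)
      - (17 + sqrt 10) / 93 * (3 * D w - 2 * A w + C w) + \<epsilon> * (D e + 7 * A e + 5 * C e)"
    unfolding long_block_form inv(1,2) q_def ..
  finally show ?thesis using 1 2 3 bw by linarith
qed

text \<open>The first period is skipped so that every extra move 2 considered comes after at least
  three blocks, hence in the box \<open>narrow\<close>.\<close>

lemma period_moves_good:
  assumes \<epsilon>: "0 \<le> \<epsilon>" "1 \<le> \<epsilon> * (1 + real k)" and j: "4 * k + 1 \<le> j"
  shows "good ((17 + sqrt 10) / 31 - \<epsilon>) (period_moves k j) (A j) (C j) (D j)"
proof -
  define t q :: real where "t = (17 + sqrt 10) / 31 - \<epsilon>" and "q = 813 / 1250"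
  have "(17 + sqrt 10) / 31 \<le> q" using sqrt10_bounds unfolding q_def by (simp add: field_simps)
  then have tq: "t \<le> q" using \<epsilon> unfolding t_def by linarith
  have tm: "t * s \<le> q * s" if "0 \<le> s" for s using tq that by (rule mult_right_mono)
  have weaken: "block_conds q t a c d" if "block_conds q q a c d" "0 \<le> a" "0 \<le> c" "0 \<le> d" for a c d
    using that tm[of "d + 4 * a + 3 * c"] unfolding block_conds_def by simp
  show ?thesis
  proof (cases j k rule: period_moves_cases)
    case (1 p)
    then obtain r where r: "p = Suc r" using j by (cases p) auto
    note bd = orbit_bounds[OF orb, of j]
    have "narrow (A j) (C j) (D j)" using narrow_start[of r] 1 r by simp
    from narrow_conds(2,3)[OF this] bd
    have "q * (A j + C j) < D j + C j" "q * (D j + C j) < A j" by (simp_all add: q_def)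
    moreover have "period_moves k j = 2" unfolding 1 by (rule period_moves_start)
    ultimately show ?thesis
      using le_less_trans[OF tm[of "A j + C j"]] le_less_trans[OF tm[of "D j + C j"]] bd
      unfolding good_def t_def[symmetric] by simp
  next
    case (2 p b l)
    then have "p \<noteq> 0" using j by (cases "p = 0") auto
    then obtain r where r: "p = Suc r" by (cases p) auto
    define i where "i = start p + 1 + 4 * b"
    define e where "e = start (Suc r)"
    note be = orbit_bounds[OF orb, of e]
    have ne: "narrow (A e) (C e) (D e)" unfolding e_def by (rule narrow_start)
    have "block_conds q t (A i) (C i) (D i)"
    proof (cases "3 \<le> b")
      case True
      then show ?thesis
        using narrow_conds(1)[OF narrow_late[of b p]] 2(1) weaken orbit_bounds[OF orb, of i]
        unfolding i_def q_def by simp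
    next
      case False
      \<comment> \<open>The first three blocks of a period start in states disturbed by the extra
        move 2; these states are computed from the one at e, which lies in the box.\<close>
      have pe: "period_moves k e = 2" unfolding e_def by (rule period_moves_start)
      have 0: "A (e + 1) = A e + C e" "C (e + 1) = A e" "D (e + 1) = D e + C e"
        using move2[OF orb pe] by simp_all
      have bl: "block (period_moves k) (e + 1)" "block (period_moves k) (e + 5)"
        using blocks_before_start[of 0 "Suc r"] blocks_before_start[of 1 "Suc r"] k
        unfolding e_def by (simp_all add: ac_simps)
      have 1: "A (e + 5) = 8 * A e + 5 * C e" "C (e + 5) = 3 * A e + 2 * C e" "D (e + 5) = D e + 4 * A e + 3 * C e"
        using block_states(10-12)[OF orb bl(1)] unfolding 0 by (simp_all add: ac_simps)
      have 2: "A (e + 9) = 49 * A e + 31 * C e" "C (e + 9) = 19 * A e + 12 * C e" "D (e + 9) = D e + 26 * A e + 17 * C e"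
        using block_states(10-12)[OF orb bl(2)] unfolding 1 by (simp_all add: ac_simps)
      have crit: "t * (D e + 7 * A e + 5 * C e) < 5 * A e + 3 * C e"
        unfolding t_def e_def by (rule critical_condition[OF \<epsilon>])
      have pos: "0 < A e" using be by simp
      note nc = narrow_conds[OF ne pos, folded q_def]
      consider "b = 0" "i = e + 1" | "b = 1" "i = e + 5" | "b = 2" "i = e + 9"
        using False unfolding i_def e_def r by fastforce
      then show ?thesis
      proof cases
        case 1
        then show ?thesis using nc(4)[OF crit] 0 by simp
      next
        case c: 2
        show ?thesis unfolding c(2) 1 using nc(5) be by (intro weaken) simp_all
      next
        case 3
        show ?thesis unfolding 3(2) 2 using nc(6) be by (intro weaken) simp_all
      qed
    qed
    moreover have "block (period_moves k) i" unfolding i_def by (rule blocks_before_start[OF 2(1)])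
    ultimately have "good t (period_moves k (i + l)) (A (i + l)) (C (i + l)) (D (i + l))"
      using block_good[OF orb _ _ tq 2(2)] by blast
    then show ?thesis unfolding t_def i_def 2(3) .
  qed
qed

text \<open>A strict inequality for the exponent requires failures at a fixed threshold below
  \<open>r_one - 1\<close>. By \<open>two_long_blocks\<close> the condition is violated by at least
  A i / 3, while D + C is at most 13 A e \<le> 13 * 11 * 8 ^ k A i, and 143/1000 < 1/3.\<close>

lemma period_moves_not_good:
  "\<exists>j\<ge>J. \<not> good ((17 + sqrt 10) / 31 - 1 / (1000 * 8 ^ k)) (period_moves k j) (A j) (C j) (D j)"
proof -
  define i where "i = start J + 1 + 4 * (k - 1)"
  define e where "e = start (Suc (Suc J))"
  have i4: "i + 4 = start (Suc J)" using k start_Suc[of J] unfolding i_def by simp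
  have i5: "i + 5 = start (Suc J) + 1" using i4 by simp
  have bi: "block (period_moves k) i" unfolding i_def using k by (intro blocks_before_start) simp
  have m4: "period_moves k (i + 4) = 2" unfolding i4 by (rule period_moves_start)
  have bl: "block (period_moves k) (i + 5 + 4 * l)" if "l < k" for l
    unfolding i5 by (rule blocks_before_start[OF that])
  have e: "e = i + 5 + 4 * k" unfolding e_def i5 start_Suc ..
  have "block (period_moves k) (e + 1)" using blocks_before_start[of 0 "Suc (Suc J)"] k unfolding e_def by simp
  moreover have pe: "period_moves k e = 2" unfolding e_def by (rule period_moves_start)
  ultimately have me: "period_moves k e = 2" "period_moves k (e + 1) = 2" "period_moves k (e + 2) = 2"
    "period_moves k (e + 3) = 2" "period_moves k (e + 4) = 3"
    unfolding block_def by (simp_all add: numeral_eq_Suc)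
  have two: "A (e + 4) - (17 + sqrt 10) / 31 * (D (e + 4) + C (e + 4)) \<le> - A i / 3"
    by (rule two_long_blocks[OF orb bi m4 _ e me(1-4)]) (rule bl)
  have Ci: "C i \<le> A i" using C_le_A[of "start J + 4 * (k - 1)"] unfolding i_def by simp
  note bd = orbit_bounds[OF orb, of i] orbit_bounds[OF orb, of e]
  have "A (i + 5) = A (i + 4) + C (i + 4)" "A (i + 4) = 5 * A i + 3 * C i" "C (i + 4) = 2 * A i + C i"
    using move2[OF orb m4] block_states(10,11)[OF orb bi] by (simp_all add: numeral_eq_Suc)
  then have "A (i + 5) \<le> 11 * A i" using Ci by simp
  then have "8 ^ k * A (i + 5) \<le> 8 ^ k * (11 * A i)" by (intro mult_left_mono) auto
  moreover have "C (i + 5) \<le> A (i + 5)" using C_le_A[of "i + 4"] by (simp add: numeral_eq_Suc)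
  moreover have "\<forall>l<k. block (period_moves k) (i + 5 + 4 * l)" using bl by blast
  from blocks_invariants(4)[OF orb this calculation(2)]
  have "C e \<le> A e" "A e \<le> 8 ^ k * A (i + 5)" unfolding e by simp_all
  ultimately have "C e \<le> A e" "A e \<le> 8 ^ k * (11 * A i)" by linarith+
  moreover have "D (e + 4) + C (e + 4) = D e + 7 * A e + 5 * C e"
    using long_block_state[OF orb me(1-4)] by simp
  ultimately have S: "D (e + 4) + C (e + 4) \<le> 143 * (8 ^ k * A i)" using bd by simp
  have "\<not> good ((17 + sqrt 10) / 31 - 1 / (1000 * 8 ^ k)) (period_moves k (e + 4)) (A (e + 4)) (C (e + 4)) (D (e + 4))"
  proof
    assume "good ((17 + sqrt 10) / 31 - 1 / (1000 * 8 ^ k)) (period_moves k (e + 4)) (A (e + 4)) (C (e + 4)) (D (e + 4))"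
    then have "((17 + sqrt 10) / 31 - 1 / (1000 * 8 ^ k)) * (D (e + 4) + C (e + 4)) < A (e + 4)"
      using me(5) by (simp add: good_def)
    then have "A i / 3 < 1 / (1000 * 8 ^ k) * (D (e + 4) + C (e + 4))"
      using two unfolding left_diff_distrib by linarith
    also have "\<dots> \<le> 1 / (1000 * 8 ^ k) * (143 * (8 ^ k * A i))" using S by (intro mult_left_mono) auto
    also have "\<dots> = 143 / 1000 * A i" by simp
    finally show False using bd by simp
  qed
  moreover have "J \<le> e + 4" unfolding e_def by simp
  ultimately show ?thesis by blast
qed

end

lemma Sturmian_near_r_one:
  assumes "0 < \<epsilon>"
  shows "\<exists>x\<in>Sturmian. ereal (r_one - \<epsilon>) \<le> rep x \<and> rep x < ereal r_one"
proof -
  define \<rho> where "\<rho> = (17 + sqrt 10) / 31"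
  have r1: "r_one = 1 + \<rho>" by (simp add: r_one_def \<rho>_def field_simps)
  have \<rho>: "6 / 10 < \<rho>" "\<rho> < 7 / 10" using sqrt10_bounds by (simp_all add: \<rho>_def)
  \<comment> \<open>The cap 1/2 keeps the threshold \<rho> - \<delta> nonnegative.\<close>
  define \<delta> where "\<delta> = min \<epsilon> (1 / 2)"
  have \<delta>: "0 < \<delta>" "\<delta> \<le> \<epsilon>" "\<delta> \<le> 1 / 2" using assms by (auto simp: \<delta>_def)
  obtain n :: nat where n: "1 / \<delta> < real n" using reals_Archimedean2 by blast
  define k where "k = n + 3"
  have "1 \<le> \<delta> * real n" using n \<delta> by (simp add: field_simps)
  also have "\<dots> \<le> \<delta> * (1 + real k)" using \<delta> by (intro mult_left_mono) (auto simp: k_def)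
  finally have dk: "1 \<le> \<delta> * (1 + real k)" .
  have "period_moves k j = 2 \<or> period_moves k j = 3" for j by (simp add: period_moves_def)
  from realise_moves[of "period_moves k", OF this period_moves_next]
  obtain x F where x: "x \<in> Sturmian" and dir: "directed x F (period_moves k)" by blast
  note orb = directed_orbit[OF dir]
  have k3: "3 \<le> k" by (simp add: k_def)
  have "ereal (1 + (\<rho> - \<delta>)) \<le> rep x"
  proof (rule directed_rep_ge[OF dir x])
    show "0 \<le> \<rho> - \<delta>" "\<rho> - \<delta> \<le> 1" using \<rho> \<delta> by auto
    show "period_moves k j \<noteq> 1" for j by (simp add: period_moves_def)
    show "good (\<rho> - \<delta>) (period_moves k j) (size_u (F j)) (size_v (F j)) (size_w (F j))" if "4 * k + 1 \<le> j" for j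
      unfolding \<rho>_def using period_moves_good[OF orb k3 less_imp_le[OF \<delta>(1)] dk that] .
  qed
  moreover have "ereal (r_one - \<epsilon>) \<le> ereal (1 + (\<rho> - \<delta>))" using r1 \<delta> by simp
  ultimately have "ereal (r_one - \<epsilon>) \<le> rep x" by (rule order.trans[rotated])
  moreover have "rep x < ereal r_one"
  proof (rule ccontr)
    assume "\<not> rep x < ereal r_one"
    then have ge: "ereal r_one \<le> rep x" by simp
    define t where "t = \<rho> - 1 / (1000 * 8 ^ k)"
    have "(1 :: real) \<le> 8 ^ k" by simp
    then have "1 / (1000 * 8 ^ k) \<le> (1 / 1000 :: real)" by (intro divide_left_mono) auto
    moreover have "0 < 1 / (1000 * 8 ^ k :: real)" by simp
    ultimately have t: "0 < t" "t < \<rho>" unfolding t_def using \<rho> by linarith+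
    have "ereal (1 + t) < ereal r_one" using t r1 by simp
    then have "ereal (1 + t) < rep x" using ge by (rule less_le_trans)
    from directed_good[OF dir t(1) this] show False
      using period_moves_not_good[OF orb k3] unfolding t_def \<rho>_def by blast
  qed
  ultimately show ?thesis using x by blast
qed

theorem theorem0p4:
  shows "\<not> (\<exists>x\<in>Sturmian. ereal r_one < rep x \<and> rep x < ereal r_max)
    \<and> rep ` Sturmian \<subseteq> range ereal
    \<and> r_one islimpt {s :: real. ereal s \<in> rep ` Sturmian}"
proof (intro conjI)
  show "\<not> (\<exists>x\<in>Sturmian. ereal r_one < rep x \<and> rep x < ereal r_max)"
    using Sturmian_gap by (meson not_le)
  show "rep ` Sturmian \<subseteq> range ereal" using Sturmian_rep_real by blast
  show "r_one islimpt {s :: real. ereal s \<in> rep ` Sturmian}"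
    unfolding islimpt_approachable
  proof (intro allI impI)
    fix e :: real assume "0 < e"
    then have "0 < e / 2" by simp
    from Sturmian_near_r_one[OF this] obtain x where x: "x \<in> Sturmian"
      "ereal (r_one - e / 2) \<le> rep x" "rep x < ereal r_one" by blast
    obtain s where s: "rep x = ereal s" using Sturmian_rep_real[OF x(1)] by blast
    have "ereal s \<in> rep ` Sturmian" using x(1) s by (metis imageI)
    moreover have "s \<noteq> r_one" "dist s r_one < e" using x(2,3) \<open>0 < e\<close> unfolding s by (auto simp: dist_real_def)
    ultimately show "\<exists>s\<in>{s. ereal s \<in> rep ` Sturmian}. s \<noteq> r_one \<and> dist s r_one < e" by blast
  qed
qed

end
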